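(* Consider the multi-level caching setup with $L$ levels, $K$ caches and, for each level $i\in\{1,\dots,L\}$, $U_i$ users per cache with access degree $d_i$ and $N_i\ge KU_i$ files. Then for any $M\ge 0$ the following rate is achievable (that is, the rate-memory pair $(R(M),M)$ is achievable): $$R(M)=\sum_{h\in H}KU_h+\frac{\left(\sum_{i\in I}\sqrt{N_iU_i}\right)^2}{M-\sum_{j\in J}N_j/d_j}-\sum_{i\in I}d_iU_i,$$ where $(H,I,J)$ is an $M$-feasible partition of the set of levels $\{1,\dots,L\}$. (If $I=\emptyset$, the second and third terms are read as $0$.)
   Context: Setup. All of $L,K,N_i,U_i,d_i$ are positive integers with $d_i\le K$. A server hosts files of $F$ bits each, independent and uniformly distributed; level $i$ has $N_i$ files. There are $K$ caches (access points) arranged cyclically (cache $K$ is adjacent to cache $1$), each storing $MF$ bits, with $M\ge0$ real. For each level $i$ and each $k\in\{1,\dots,K\}$ there are $U_i$ users who access exactly the $d_i$ consecutive caches $k,k+1,\dots,k+d_i-1$ (indices cyclic modulo $K$); each such user requests one file of level $i$. In the placement phase the caches are filled as functions of the files, before the requests are known. In the delivery phase, once all requests are known, the server sends one broadcast message (a function of all files and of the requests) heard by all users; each user must recover its requested file from the broadcast and the contents of the caches it accesses. Achievability. $(R,M)$ is achievable if there is a placement strategy in caches of $MF$ bits such that, for every request profile, a broadcast of $RF$ bits can be delivered that satisfies all the requests. This is understood asymptotically in the file size: for every $\varepsilon>0$ and all sufficiently large $F$ there is a placement such that, for every request profile, a broadcast of at most $(R+\varepsilon)F$ bits lets all users recover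 their requested files with error probability at most $\varepsilon$. $M$-feasible partition. For $A\subseteq\{1,\dots,L\}$ let $S_A=\sum_{i\in A}\sqrt{N_iU_i}$ and $T_A=\sum_{i\in A}N_i/d_i$. A partition $(H,I,J)$ of $\{1,\dots,L\}$ (parts may be empty) is $M$-feasible if for all $h\in H$: $M<\frac1K\sqrt{N_h/U_h}\,S_I+T_J+\frac{N_h}{K}$; for all $i\in I$: $\frac1K\sqrt{N_i/U_i}\,S_I+T_J\le M\le\frac1{d_i}\sqrt{N_i/U_i}\,S_I+T_J$; for all $j\in J$: $\frac1{d_j}\sqrt{N_j/U_j}\,S_I+T_J<M$. *)

theory Defs
  imports "HOL-Probability.Probability" "HOL-Probability.Product_PMF"
begin

text \<open>
  Parameters throughout: \<open>L\<close> levels \<open>{1..L}\<close>, \<open>K\<close> caches \<open>{1..K}\<close>; for level \<open>i\<close>, \<open>N i\<close> files,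
  \<open>U i\<close> users per cache and access degree \<open>d i\<close>.
  A file is named by the pair (level, index within the level), a user by the triple
  (level, first cache accessed, index among the users sharing these two).
\<close>

type_synonym library = "nat \<times> nat \<Rightarrow> bool list"
type_synonym user = "nat \<times> nat \<times> nat"

definition files :: "nat \<Rightarrow> (nat \<Rightarrow> nat) \<Rightarrow> (nat \<times> nat) set" where
  "files L N = (SIGMA i:{1..L}. {1..N i})"

definition users :: "nat \<Rightarrow> nat \<Rightarrow> (nat \<Rightarrow> nat) \<Rightarrow> user set" where
  "users L K U = (SIGMA i:{1..L}. {1..K} \<times> {1..U i})"

definition library_pmf :: "nat \<Rightarrow> (nat \<Rightarrow> nat) \<Rightarrow> nat \<Rightarrow> library pmf" where
  "library_pmf L N F = Pi_pmf (files L N) [] (\<lambda>_. pmf_of_set {w :: bool list. length w = F})"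

text \<open>The caches \<open>k, k + 1, \<dots>, k + d - 1\<close>, wrapped around cyclically within \<open>{1..K}\<close>.\<close>

definition accessed :: "nat \<Rightarrow> (nat \<Rightarrow> nat) \<Rightarrow> user \<Rightarrow> nat set" where
  "accessed K d = (\<lambda>(i, k, u). (\<lambda>m. (k - 1 + m) mod K + 1) ` {..<d i})"

definition request_profile ::
    "nat \<Rightarrow> nat \<Rightarrow> (nat \<Rightarrow> nat) \<Rightarrow> (nat \<Rightarrow> nat) \<Rightarrow> (user \<Rightarrow> nat) \<Rightarrow> bool" where
  "request_profile L K N U r \<longleftrightarrow> (\<forall>(i, k, u)\<in>users L K U. r (i, k, u) \<in> {1..N i})"

text \<open>
  \<open>Z c W\<close> is the content of cache \<open>c\<close> when the library is \<open>W\<close>.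
  Messages have a length that does not depend on the files, so that a length cannot carry
  information.  The message \<open>X\<close> and the decoders \<open>g\<close> are chosen after the profile \<open>r\<close>;
  decoder \<open>g v\<close> sees the message and the contents of the caches that user \<open>v\<close> accesses, all other
  caches being masked by \<^term>\<open>restrict\<close>.
\<close>

definition deliverable ::
    "nat \<Rightarrow> nat \<Rightarrow> (nat \<Rightarrow> nat) \<Rightarrow> (nat \<Rightarrow> nat) \<Rightarrow> (nat \<Rightarrow> nat) \<Rightarrow> nat \<Rightarrow>
     (nat \<Rightarrow> library \<Rightarrow> bool list) \<Rightarrow> (user \<Rightarrow> nat) \<Rightarrow> real \<Rightarrow> real \<Rightarrow> bool" where
  "deliverable L K N U d F Z r B \<epsilon> \<longleftrightarrow>
     (\<exists>(X :: library \<Rightarrow> bool list) (g :: user \<Rightarrow> bool list \<Rightarrow> (nat \<Rightarrow> bool list) \<Rightarrow> bool list) b.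
        real b \<le> B \<and> (\<forall>W. length (X W) = b) \<and>
        measure_pmf.prob (library_pmf L N F)
          {W. \<exists>v\<in>users L K U. g v (X W) (\<lambda>c\<in>accessed K d v. Z c W) \<noteq> W (fst v, r v)} \<le> \<epsilon>)"

definition achievable ::
    "nat \<Rightarrow> nat \<Rightarrow> (nat \<Rightarrow> nat) \<Rightarrow> (nat \<Rightarrow> nat) \<Rightarrow> (nat \<Rightarrow> nat) \<Rightarrow> real \<Rightarrow> real \<Rightarrow> bool" where
  "achievable L K N U d R M \<longleftrightarrow>
     (\<forall>\<epsilon>>0. \<forall>\<^sub>F F in sequentially.
        \<exists>Z :: nat \<Rightarrow> library \<Rightarrow> bool list.
          (\<forall>c\<in>{1..K}. \<forall>W. length (Z c W) = nat \<lfloor>M * real F\<rfloor>) \<and>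
          (\<forall>r. request_profile L K N U r \<longrightarrow>
             deliverable L K N U d F Z r ((R + \<epsilon>) * real F) \<epsilon>))"

definition S_sum :: "(nat \<Rightarrow> nat) \<Rightarrow> (nat \<Rightarrow> nat) \<Rightarrow> nat set \<Rightarrow> real" where
  "S_sum N U A = (\<Sum>i\<in>A. sqrt (real (N i) * real (U i)))"

definition T_sum :: "(nat \<Rightarrow> nat) \<Rightarrow> (nat \<Rightarrow> nat) \<Rightarrow> nat set \<Rightarrow> real" where
  "T_sum N d A = (\<Sum>i\<in>A. real (N i) / real (d i))"

definition feasible_partition ::
    "nat \<Rightarrow> nat \<Rightarrow> (nat \<Rightarrow> nat) \<Rightarrow> (nat \<Rightarrow> nat) \<Rightarrow> (nat \<Rightarrow> nat) \<Rightarrow> real \<Rightarrow>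
     nat set \<Rightarrow> nat set \<Rightarrow> nat set \<Rightarrow> bool" where
  "feasible_partition L K N U d M H I J \<longleftrightarrow>
     H \<union> I \<union> J = {1..L} \<and> H \<inter> I = {} \<and> H \<inter> J = {} \<and> I \<inter> J = {} \<and>
     (\<forall>h\<in>H. M < 1 / real K * sqrt (real (N h) / real (U h)) * S_sum N U I + T_sum N d J
                  + real (N h) / real K) \<and>
     (\<forall>i\<in>I. 1 / real K * sqrt (real (N i) / real (U i)) * S_sum N U I + T_sum N d J \<le> M \<and>
             M \<le> 1 / real (d i) * sqrt (real (N i) / real (U i)) * S_sum N U I + T_sum N d J) \<and>
     (\<forall>j\<in>J. 1 / real (d j) * sqrt (real (N j) / real (U j)) * S_sum N U I + T_sum N d J < M)"

end

theory Submission
  imports Defs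
begin

text \<open>
  Split the memory: a level in \<open>H\<close> gets none and is sent uncoded, a level in \<open>J\<close> gets \<open>N / d\<close>
  and is stored with an MDS code, so that any \<open>d\<close> caches determine its files, and level \<open>i \<in> I\<close> gets the
  share \<open>sqrt (N U) (M - T\<^sub>J) / S\<^sub>I\<close>, which feasibility places between \<open>N / K\<close> and \<open>N / d\<close>.
  It remains to serve a single level with memory \<open>\<mu>\<close> in this range at rate \<open>U (N / \<mu> - d)\<close>.  For integer
  \<open>t = K \<mu> / N\<close> coded multicasting, with every subfile stored in \<open>t\<close> caches at least \<open>d\<close> apart, has
  rate \<open>(K - t d) / (t + 1)\<close> per user of each cache; memory sharing between this scheme and the MDS
  code covers all \<open>\<mu>\<close>.  The decoding is free of errors.
\<close>

section \<open>Zero-error schemes for one level\<close>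

text \<open>The shares in \<open>I\<close> come from an optimisation: under a fixed sum
  \<open>M - T\<close> of the shares, the sum of \<open>U i * N i / \<mu> i\<close> is least when
  \<open>\<mu> i\<close> is proportional to \<open>sqrt (N i * U i)\<close>, by Cauchy-Schwarz, and
  the minimum is \<open>S\<^sup>2 / (M - T)\<close>, the middle term of the rate. Copies of a
  subfile are kept \<open>d\<close> apart because a user gains nothing from seeing the same subfile
  twice. Then \<open>t\<close> copies reach \<open>t * d\<close> of the \<open>K\<close> users,
  which is the origin of \<open>K - t * d\<close>. The price is that only sparse subsets of the
  cycle are allowed; contracting blocks turns them back into arbitrary subsets, on which the usual
  multicasting argument works. The bookkeeping is shaped by the fact that tolerance is granted to
  the broadcast alone, while caches may not exceed \<open>M * F\<close> bits. Coding over bits and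
  lengths that do not divide both cost extra, so each scheme is cut down to the memory at hand and
  the bits left out are sent uncoded.\<close>

definition agree :: "(('a \<Rightarrow> 'b \<Rightarrow> bool) \<Rightarrow> bool) set \<Rightarrow> ('a \<Rightarrow> 'b \<Rightarrow> bool) \<Rightarrow> ('a \<Rightarrow> 'b \<Rightarrow> bool) \<Rightarrow> bool" where
  "agree \<Phi> w w' \<longleftrightarrow> (\<forall>\<phi>\<in>\<Phi>. \<phi> w = \<phi> w')"

text \<open>
  Cache contents and messages are sets of Boolean functionals of the files \<open>w\<close>, where \<open>w a p\<close> is bit
  \<open>p\<close> of file \<open>a\<close>, so that lengths are cardinalities and order is irrelevant.  Decodability says that
  whatever agrees on the observed functionals agrees on the requested file.  Caches and
  users are numbered from \<open>0\<close>, with one user per cache.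
\<close>

definition delivers ::
    "nat \<Rightarrow> nat \<Rightarrow> 'b set \<Rightarrow> (nat \<Rightarrow> (('a \<Rightarrow> 'b \<Rightarrow> bool) \<Rightarrow> bool) set) \<Rightarrow> (nat \<Rightarrow> 'a) \<Rightarrow>
     (('a \<Rightarrow> 'b \<Rightarrow> bool) \<Rightarrow> bool) set \<Rightarrow> bool" where
  "delivers K d P \<Phi> r \<Psi> \<longleftrightarrow>
     (\<forall>k<K. \<forall>w w'. agree \<Psi> w w' \<longrightarrow> (\<forall>j<d. agree (\<Phi> ((k + j) mod K)) w w') \<longrightarrow>
        (\<forall>p\<in>P. w (r k) p = w' (r k) p))"

definition scheme :: "nat \<Rightarrow> nat \<Rightarrow> 'a set \<Rightarrow> 'b set \<Rightarrow> nat \<Rightarrow> nat \<Rightarrow> bool" where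
  "scheme K d Q P m b \<longleftrightarrow>
     (\<exists>\<Phi> :: nat \<Rightarrow> (('a \<Rightarrow> 'b \<Rightarrow> bool) \<Rightarrow> bool) set.
        (\<forall>c. finite (\<Phi> c) \<and> card (\<Phi> c) \<le> m) \<and>
        (\<forall>r. r ` {..<K} \<subseteq> Q \<longrightarrow> (\<exists>\<Psi>. finite \<Psi> \<and> card \<Psi> \<le> b \<and> delivers K d P \<Phi> r \<Psi>)))"

lemma deliversI:
  assumes "\<And>k w w' p. k < K \<Longrightarrow> agree \<Psi> w w' \<Longrightarrow> (\<And>j. j < d \<Longrightarrow> agree (\<Phi> ((k + j) mod K)) w w') \<Longrightarrow>
             p \<in> P \<Longrightarrow> w (r k) p = w' (r k) p"
  shows "delivers K d P \<Phi> r \<Psi>"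
  unfolding delivers_def using assms by simp

lemma deliversD:
  assumes "delivers K d P \<Phi> r \<Psi>" and "k < K" and "agree \<Psi> w w'"
    and "\<And>j. j < d \<Longrightarrow> agree (\<Phi> ((k + j) mod K)) w w'" and "p \<in> P"
  shows "w (r k) p = w' (r k) p"
  using assms unfolding delivers_def by simp

lemma agreeD: "agree \<Phi> w w' \<Longrightarrow> \<phi> \<in> \<Phi> \<Longrightarrow> \<phi> w = \<phi> w'"
  by (simp add: agree_def)

lemma agree_Un: "agree (\<Phi> \<union> \<Psi>) w w' \<longleftrightarrow> agree \<Phi> w w' \<and> agree \<Psi> w w'"
  by (auto simp: agree_def)

lemma agree_UN: "agree (\<Union>x\<in>A. \<Phi> x) w w' \<longleftrightarrow> (\<forall>x\<in>A. agree (\<Phi> x) w w')"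
  by (auto simp: agree_def)

lemma schemeE:
  assumes "scheme K d Q P m b"
  obtains \<Phi> where "\<And>c. finite (\<Phi> c)" and "\<And>c. card (\<Phi> c) \<le> m"
    and "\<And>r. r ` {..<K} \<subseteq> Q \<Longrightarrow> \<exists>\<Psi>. finite \<Psi> \<and> card \<Psi> \<le> b \<and> delivers K d P \<Phi> r \<Psi>"
  using assms unfolding scheme_def by blast

section \<open>Combining schemes: renaming bits, splitting files, filling up lengths\<close>

lemma scheme_reindex:
  fixes e :: "'b \<Rightarrow> 'c"
  assumes "scheme K d Q P m b"
  shows "scheme K d Q (e ` P) m b"
proof -
  obtain \<Phi> where \<Phi>: "\<And>c. finite (\<Phi> c)" "\<And>c. card (\<Phi> c) \<le> m"
    and dec: "\<And>r. r ` {..<K} \<subseteq> Q \<Longrightarrow> \<exists>\<Psi>. finite \<Psi> \<and> card \<Psi> \<le> b \<and> delivers K d P \<Phi> r \<Psi>"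
    using schemeE[OF assms] by blast
  \<comment> \<open>The scheme runs on virtual files, whose bit \<open>p\<close> is bit
    \<open>e p\<close> of the actual file.\<close>
  define pull where "pull \<phi> w = \<phi> (\<lambda>a p. w a (e p))"
    for \<phi> :: "('a \<Rightarrow> 'b \<Rightarrow> bool) \<Rightarrow> bool" and w :: "'a \<Rightarrow> 'c \<Rightarrow> bool"
  have agree_pull: "agree (pull ` X) w w' \<longleftrightarrow> agree X (\<lambda>a p. w a (e p)) (\<lambda>a p. w' a (e p))" for X w w'
    by (simp add: agree_def pull_def)
  have card_pull: "card (pull ` X) \<le> n" if "finite X" "card X \<le> n" for X n
    using card_image_le[OF that(1), of pull] that(2) by linarith
  show ?thesis
    unfolding scheme_def
  proof (intro exI[of _ "\<lambda>c. pull ` \<Phi> c"] conjI allI impI)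
    show "finite (pull ` \<Phi> c)" and "card (pull ` \<Phi> c) \<le> m" for c
      using \<Phi> by (simp_all add: card_pull)
    fix r assume "r ` {..<K} \<subseteq> Q"
    then obtain \<Psi> where \<Psi>: "finite \<Psi>" "card \<Psi> \<le> b" and D: "delivers K d P \<Phi> r \<Psi>"
      using dec by blast
    have "delivers K d (e ` P) (\<lambda>c. pull ` \<Phi> c) r (pull ` \<Psi>)"
    proof (rule deliversI)
      fix k w w' p
      assume "k < K" "agree (pull ` \<Psi>) w w'" "p \<in> e ` P"
        and "\<And>j. j < d \<Longrightarrow> agree (pull ` \<Phi> ((k + j) mod K)) w w'"
      then show "w (r k) p = w' (r k) p"
        using deliversD[OF D, of k "\<lambda>a p. w a (e p)" "\<lambda>a p. w' a (e p)"] by (auto simp: agree_pull)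
    qed
    moreover have "finite (pull ` \<Psi>)" "card (pull ` \<Psi>) \<le> b"
      using \<Psi> by (simp_all add: card_pull)
    ultimately show "\<exists>\<Psi>. finite \<Psi> \<and> card \<Psi> \<le> b \<and> delivers K d (e ` P) (\<lambda>c. pull ` \<Phi> c) r \<Psi>"
      by blast
  qed
qed

lemma scheme_Un:
  assumes "scheme K d Q P m b" and "scheme K d Q P' m' b'"
  shows "scheme K d Q (P \<union> P') (m + m') (b + b')"
proof -
  obtain \<Phi> where \<Phi>: "\<And>c. finite (\<Phi> c)" "\<And>c. card (\<Phi> c) \<le> m"
    and dec: "\<And>r. r ` {..<K} \<subseteq> Q \<Longrightarrow> \<exists>\<Psi>. finite \<Psi> \<and> card \<Psi> \<le> b \<and> delivers K d P \<Phi> r \<Psi>"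
    using schemeE[OF assms(1)] by blast
  obtain \<Phi>' where \<Phi>': "\<And>c. finite (\<Phi>' c)" "\<And>c. card (\<Phi>' c) \<le> m'"
    and dec': "\<And>r. r ` {..<K} \<subseteq> Q \<Longrightarrow> \<exists>\<Psi>. finite \<Psi> \<and> card \<Psi> \<le> b' \<and> delivers K d P' \<Phi>' r \<Psi>"
    using schemeE[OF assms(2)] by blast
  have card_Un: "card (X \<union> Y) \<le> n + n'" if "card X \<le> n" "card Y \<le> n'"
    for X Y :: "(('a \<Rightarrow> 'b \<Rightarrow> bool) \<Rightarrow> bool) set" and n n'
    using card_Un_le[of X Y] that by linarith
  show ?thesis
    unfolding scheme_def
  proof (intro exI[of _ "\<lambda>c. \<Phi> c \<union> \<Phi>' c"] conjI allI impI)
    show "finite (\<Phi> c \<union> \<Phi>' c)" and "card (\<Phi> c \<union> \<Phi>' c) \<le> m + m'" for c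
      using \<Phi> \<Phi>' by (simp_all add: card_Un)
    fix r assume r: "r ` {..<K} \<subseteq> Q"
    obtain \<Psi> where \<Psi>: "finite \<Psi>" "card \<Psi> \<le> b" and D: "delivers K d P \<Phi> r \<Psi>"
      using dec[OF r] by blast
    obtain \<Psi>' where \<Psi>': "finite \<Psi>'" "card \<Psi>' \<le> b'" and D': "delivers K d P' \<Phi>' r \<Psi>'"
      using dec'[OF r] by blast
    have "delivers K d (P \<union> P') (\<lambda>c. \<Phi> c \<union> \<Phi>' c) r (\<Psi> \<union> \<Psi>')"
    proof (rule deliversI)
      fix k w w' p
      assume "k < K" "agree (\<Psi> \<union> \<Psi>') w w'" "p \<in> P \<union> P'"
        and "\<And>j. j < d \<Longrightarrow> agree (\<Phi> ((k + j) mod K) \<union> \<Phi>' ((k + j) mod K)) w w'"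
      then show "w (r k) p = w' (r k) p"
        using deliversD[OF D, of k w w' p] deliversD[OF D', of k w w' p] by (auto simp: agree_Un)
    qed
    moreover have "finite (\<Psi> \<union> \<Psi>')" "card (\<Psi> \<union> \<Psi>') \<le> b + b'"
      using \<Psi> \<Psi>' by (simp_all add: card_Un)
    ultimately show "\<exists>\<Psi>. finite \<Psi> \<and> card \<Psi> \<le> b + b' \<and> delivers K d (P \<union> P') (\<lambda>c. \<Phi> c \<union> \<Phi>' c) r \<Psi>"
      by blast
  qed
qed

lemma scheme_uncoded:
  fixes Q :: "'a set" and P :: "'b set"
  assumes "finite P"
  shows "scheme K d Q P 0 (K * card P)"
  unfolding scheme_def
proof (intro exI[of _ "\<lambda>_. {}"] conjI allI impI)
  fix r :: "nat \<Rightarrow> 'a"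
  define read :: "nat \<times> 'b \<Rightarrow> ('a \<Rightarrow> 'b \<Rightarrow> bool) \<Rightarrow> bool"
    where "read = (\<lambda>kp w. w (r (fst kp)) (snd kp))"
  have "delivers K d P (\<lambda>_. {}) r (read ` ({..<K} \<times> P))"
  proof (rule deliversI)
    fix k w w' p
    assume "k < K" "agree (read ` ({..<K} \<times> P)) w w'" "p \<in> P"
    then have "read (k, p) w = read (k, p) w'"
      by (intro agreeD[of "read ` ({..<K} \<times> P)"]) simp_all
    then show "w (r k) p = w' (r k) p"
      by (simp add: read_def)
  qed
  moreover have "card (read ` ({..<K} \<times> P)) \<le> K * card P"
    using card_image_le[of "{..<K} \<times> P" read] assms by (simp add: card_cartesian_product)
  moreover have "finite (read ` ({..<K} \<times> P))"
    using assms by simp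
  ultimately show "\<exists>\<Psi>. finite \<Psi> \<and> card \<Psi> \<le> K * card P \<and> delivers K d P (\<lambda>_. {}) r \<Psi>"
    by blast
qed auto

lemma scheme_append:
  fixes f f' :: nat
  assumes "scheme K d Q {..<f} m b" and "scheme K d Q {..<f'} m' b'"
  shows "scheme K d Q {..<f + f'} (m + m') (b + b')"
proof -
  have *: "{..<f + f'} = {..<f} \<union> (\<lambda>p. p + f) ` {..<f'}"
  proof (intro equalityI subsetI)
    fix p :: nat assume p: "p \<in> {..<f + f'}"
    show "p \<in> {..<f} \<union> (\<lambda>p. p + f) ` {..<f'}"
    proof (cases "p < f")
      case False
      then have "p = (p - f) + f" "p - f < f'" using p by auto
      then show ?thesis by blast
    qed simp
  qed auto
  show ?thesis
    unfolding * by (intro scheme_Un scheme_reindex assms)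
qed

lemma scheme_empty: "scheme K d Q {} 0 0"
  using scheme_uncoded[of "{}" K d Q] by simp

lemma scheme_repeat:
  assumes "scheme K d Q {..<f} m b"
  shows "scheme K d Q {..<n * f} (n * m) (n * b)"
proof (induction n)
  case (Suc n)
  then show ?case
    using scheme_append[OF assms Suc.IH] by (simp add: add.commute)
qed (simp add: scheme_empty)

text \<open>Where rounding losses go: the bits in excess are sent uncoded, and the memory stays as
  it was.\<close>

lemma scheme_fill:
  assumes "scheme K d Q {..<f} m b" and "f \<le> F"
  shows "scheme K d Q {..<F} m (b + K * (F - f))"
  using scheme_append[OF assms(1) scheme_uncoded[of "{..<F - f}" K d Q]] assms(2) by simp

lemma scheme_enumerate:
  assumes "scheme K d Q P m b" and "finite P"
  shows "scheme K d Q {..<card P} m b"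
proof -
  obtain e where "bij_betw e P {..<card P}"
    using ex_bij_betw_finite_nat[OF assms(2)] by (auto simp: atLeast0LessThan)
  then show ?thesis
    using scheme_reindex[OF assms(1), of e] by (simp add: bij_betw_def)
qed

section \<open>Coded placement without broadcast\<close>

text \<open>Uniqueness of interpolation over the integers modulo \<open>q\<close>, where zero
  divisors do no harm because differences of the points are units. After splitting off
  \<open>x0\<close> as \<open>p = p(x0) + (X - x0) s\<close>, the unit \<open>x - x0\<close> cancels
  at every other point, and induction applies to \<open>s\<close>. No prime modulus of the right
  size has to be found.\<close>

lemma coeff_dvd_if_dvd_values:
  fixes p :: "int poly" and q :: int
  assumes "finite S" "degree p < card S"
    and "\<And>x y. x \<in> S \<Longrightarrow> y \<in> S \<Longrightarrow> x \<noteq> y \<Longrightarrow> coprime q (x - y)"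
    and "\<And>x. x \<in> S \<Longrightarrow> q dvd poly p x"
  shows "q dvd coeff p n"
  using assms
proof (induction "card S" arbitrary: S p n)
  case (Suc c)
  then obtain x0 where x0: "x0 \<in> S" by fastforce
  define s where "s = synthetic_div p x0"
  have p: "p = [:poly p x0:] + [:- x0, 1:] * s"
    unfolding s_def by (metis add.commute synthetic_div_correct')
  have s_dvd: "q dvd coeff s n" for n
  \<comment> \<open>For constant \<open>p\<close> also \<open>degree s = 0\<close>, which breaks the
    strict degree bound if no point is left.\<close>
  proof (cases "degree p = 0")
    case True
    then have "s = 0" by (simp add: s_def synthetic_div_eq_0_iff)
    then show ?thesis by simp
  next
    case False
    show ?thesis
    proof (rule Suc.hyps(1))
      show "c = card (S - {x0})" "finite (S - {x0})"
        using Suc x0 by auto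
      show "degree s < card (S - {x0})"
        using Suc x0 False by (simp add: s_def degree_synthetic_div)
      show "coprime q (x - y)" if "x \<in> S - {x0}" "y \<in> S - {x0}" "x \<noteq> y" for x y
        using Suc.prems(3) that by blast
      show "q dvd poly s x" if "x \<in> S - {x0}" for x
      proof -
        have "poly p x = poly p x0 + (x - x0) * poly s x"
          by (subst p) (simp add: algebra_simps)
        then have "(x - x0) * poly s x = poly p x - poly p x0" by simp
        then have "q dvd (x - x0) * poly s x"
          using Suc.prems(4)[of x] Suc.prems(4)[OF x0] that by simp
        moreover have "coprime q (x - x0)"
          using Suc.prems(3) x0 that by blast
        ultimately show ?thesis
          by (simp add: coprime_dvd_mult_right_iff)
      qed
    qed
  qed
  have "coeff p n = coeff ([:poly p x0:] + [:- x0, 1:] * s) n"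
    using p by simp
  also have "q dvd \<dots>"
    using Suc.prems(4)[OF x0] s_dvd by (cases n) auto
  finally show ?case .
qed simp

lemma inj_on_window:
  fixes k d K :: nat
  assumes "d \<le> K"
  shows "inj_on (\<lambda>j. (k + j) mod K) {..<d}"
proof (rule inj_onI)
  have *: "i = j" if "i \<le> j" "j < d" "(k + i) mod K = (k + j) mod K" for i j
  proof -
    have "K dvd (k + j) - (k + i)"
      using that(3) mod_eq_dvd_iff_nat[of "k + i" "k + j" K] that(1) by simp
    then have "K dvd j - i" by simp
    then show ?thesis
      using that assms nat_dvd_not_less[of "j - i" K] by force
  qed
  fix i j assume "i \<in> {..<d}" "j \<in> {..<d}" "(k + i) mod K = (k + j) mod K"
  then show "i = j"
    using *[of i j] *[of j i] by (cases "i \<le> j") simp_all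
qed

text \<open>The difference divides \<open>fact K\<close>, so a common divisor divides both
  \<open>fact K * q\<close> and its successor.\<close>

lemma coprime_fact_diff:
  fixes x y K q :: nat
  assumes "x < K" "y < K" "x \<noteq> y"
  shows "coprime (int (fact K * q + 1)) (int x - int y)"
proof (rule coprimeI)
  fix c assume c: "c dvd int (fact K * q + 1)" "c dvd int x - int y"
  have "nat \<bar>int x - int y\<bar> dvd fact K"
    using assms by (intro dvd_fact) auto
  then have "int x - int y dvd int (fact K)"
    by (simp only: nat_abs_dvd_iff)
  then have "c dvd int (fact K) * int q"
    using c(2) dvd_trans dvd_mult2 by blast
  moreover have "c dvd int (fact K) * int q + 1"
    using c(1) by (simp add: add.commute)
  ultimately show "is_unit c"
    using dvd_add_right_iff by blast
qed

text \<open>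
  A file is cut into \<open>d\<close> blocks, read as numbers below \<open>2 ^ B\<close> and taken as coefficients of a
  polynomial, of which cache \<open>c\<close> keeps the value at \<open>c\<close> modulo \<open>fact K * 2 ^ B + 1\<close>.  Differences
  of cache numbers are units for this modulus, so any \<open>d\<close> values determine the polynomial.
\<close>

lemma scheme_coded_placement:
  fixes Q :: "'a set"
  assumes "finite Q" "d \<le> K"
  shows "scheme K d Q {..<d * B} (card Q * (B + fact K)) 0"
proof -
  define q :: nat where "q = fact K * 2 ^ B + 1"
  define block :: "('a \<Rightarrow> nat \<Rightarrow> bool) \<Rightarrow> 'a \<Rightarrow> nat \<Rightarrow> nat"
    where "block w n j = horner_sum of_bool 2 (map (\<lambda>i. w n (j * B + i)) [0..<B])" for w n j
  define pol :: "('a \<Rightarrow> nat \<Rightarrow> bool) \<Rightarrow> 'a \<Rightarrow> int poly"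
    where "pol w n = (\<Sum>j<d. monom (int (block w n j)) j)" for w n
  define code :: "nat \<Rightarrow> ('a \<Rightarrow> nat \<Rightarrow> bool) \<Rightarrow> 'a \<Rightarrow> nat"
    where "code c w n = nat (poly (pol w n) (int c) mod int q)" for c w n
  define \<Phi> where "\<Phi> c = (\<lambda>ni w. bit (code c w (fst ni)) (snd ni)) ` (Q \<times> {..<B + fact K})" for c
  have "1 * 2 ^ B \<le> fact K * (2 :: nat) ^ B"
    by (intro mult_right_mono fact_ge_1) simp
  then have q: "0 < q" "2 ^ B \<le> q"
    unfolding q_def by linarith+
  \<comment> \<open>Residues modulo \<open>q\<close> may exceed \<open>B\<close> bits. The crude
    bound \<open>fact K + 1 \<le> 2 ^ fact K\<close> caps the excess independently of
    \<open>B\<close>, so it is negligible for large \<open>B\<close>.\<close>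
  have q_le: "q \<le> 2 ^ (B + fact K)"
  proof -
    have "fact K + 1 \<le> (2 :: nat) ^ fact K"
      using less_exp[of "fact K"] by (simp add: Suc_le_eq)
    then have "2 ^ B * (fact K + 1) \<le> (2 :: nat) ^ B * 2 ^ fact K"
      by (intro mult_left_mono) auto
    moreover have "q \<le> 2 ^ B * (fact K + 1)"
      by (simp add: q_def algebra_simps)
    ultimately show ?thesis
      by (simp add: power_add)
  qed
  have code_lt: "code c w n < 2 ^ (B + fact K)" for c w n
  proof -
    have "code c w n < q"
      using q(1) by (simp add: code_def nat_less_iff)
    then show ?thesis using q_le by linarith
  qed
  have block_lt: "block w n j < 2 ^ B" for w n j
    unfolding block_def using horner_sum_bound[of "map (\<lambda>i. w n (j * B + i)) [0..<B]"] by simp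
  have coeff_pol: "coeff (pol w n) j = (if j < d then int (block w n j) else 0)" for w n j
    unfolding pol_def by (simp add: coeff_sum)
  have card_\<Phi>: "finite (\<Phi> c)" "card (\<Phi> c) \<le> card Q * (B + fact K)" for c
    using card_image_le[of "Q \<times> {..<B + fact K}" "\<lambda>ni w. bit (code c w (fst ni)) (snd ni)"] assms(1)
    by (simp_all add: \<Phi>_def card_cartesian_product)
  have "delivers K d {..<d * B} \<Phi> r {}" if r: "r ` {..<K} \<subseteq> Q" for r
  proof (rule deliversI)
    fix k w w' p
    assume k: "k < K" and agr: "\<And>j. j < d \<Longrightarrow> agree (\<Phi> ((k + j) mod K)) w w'" and p: "p \<in> {..<d * B}"
    define n where "n = r k"
    have n: "n \<in> Q" using r k by (auto simp: n_def)
    have code_eq: "code ((k + j) mod K) w n = code ((k + j) mod K) w' n" if "j < d" for j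
    proof -
      let ?c = "(k + j) mod K"
      have "bit (code ?c w n) i = bit (code ?c w' n) i" if "i < B + fact K" for i
      proof -
        have "(\<lambda>w. bit (code ?c w n) i) \<in> \<Phi> ?c"
          unfolding \<Phi>_def using n that by (intro image_eqI[of _ _ "(n, i)"]) auto
        from agreeD[OF agr[OF \<open>j < d\<close>] this] show ?thesis .
      qed
      then have "take_bit (B + fact K) (code ?c w n) = take_bit (B + fact K) (code ?c w' n)"
        by (intro bit_eqI) (auto simp: bit_take_bit_iff)
      then show ?thesis
        using code_lt by (simp add: take_bit_nat_eq_self)
    qed
    define S where "S = (\<lambda>j. int ((k + j) mod K)) ` {..<d}"
    have "inj_on (\<lambda>j. int ((k + j) mod K)) {..<d}"
      using inj_on_window[OF assms(2), of k] by (simp add: inj_on_def)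
    then have card_S: "card S = d"
      by (simp add: S_def card_image)
    have "0 < d" using p by (cases d) auto
    have dvd: "int q dvd coeff (pol w n - pol w' n) j" for j
    proof (rule coeff_dvd_if_dvd_values[of S])
      show "finite S" by (simp add: S_def)
      have "degree (pol w n - pol w' n) \<le> d - 1"
        by (intro degree_le) (auto simp: coeff_pol)
      then show "degree (pol w n - pol w' n) < card S"
        using \<open>0 < d\<close> card_S by linarith
      show "coprime (int q) (x - y)" if "x \<in> S" "y \<in> S" "x \<noteq> y" for x y
        using that k coprime_fact_diff[of _ K _ "2 ^ B"] by (auto simp: S_def q_def)
      show "int q dvd poly (pol w n - pol w' n) x" if "x \<in> S" for x
      proof -
        from that obtain j where j: "j < d" "x = int ((k + j) mod K)"
          by (auto simp: S_def)
        have "poly (pol w n) x mod int q = poly (pol w' n) x mod int q"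
          using code_eq[OF j(1)] q(1) unfolding code_def j(2) by (simp add: nat_eq_iff2)
        then show ?thesis
          by (simp add: mod_eq_dvd_iff)
      qed
    qed
    have "0 < B" using p by (cases B) auto
    define j i where "j = p div B" and "i = p mod B"
    have ji: "j < d" "i < B" "p = j * B + i"
      using p \<open>0 < B\<close> by (auto simp: j_def i_def less_mult_imp_div_less)
    \<comment> \<open>Both blocks are below \<open>2 ^ B \<le> q\<close>, so congruence modulo
      \<open>q\<close> is equality.\<close>
    have "int q dvd int (block w n j) - int (block w' n j)"
      using dvd[of j] ji(1) by (simp add: coeff_pol)
    moreover have "\<bar>int (block w n j) - int (block w' n j)\<bar> < int q"
    proof -
      have "block w n j < q" "block w' n j < q"
        using block_lt[of w n j] block_lt[of w' n j] q(2) by linarith+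
      then show ?thesis by linarith
    qed
    ultimately have "int (block w n j) - int (block w' n j) = 0"
      using dvd_imp_le_int[of "int (block w n j) - int (block w' n j)" "int q"] by linarith
    then have "bit (block w n j) i = bit (block w' n j) i"
      by simp
    then show "w (r k) p = w' (r k) p"
      using ji by (simp add: block_def bit_horner_sum_bit_iff n_def)
  qed
  then show ?thesis
    unfolding scheme_def using card_\<Phi> by (intro exI[of _ \<Phi>]) (auto intro!: exI[of _ "{}"])
qed

section \<open>Cyclic coded multicasting\<close>

text \<open>
  A \<open>t\<close>-subset \<open>T\<close> of \<open>{..<K - t (d - 1)}\<close> encodes \<open>t\<close> disjoint blocks of \<open>d\<close> consecutive caches,
  each contracted to a point: the block of \<open>x \<in> T\<close> starts at \<open>spread d T x\<close>, and its last cache stores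
  the subfile indexed by \<open>T\<close>.  User \<open>k\<close> misses this subfile only if its cache lies outside all blocks.
  For a \<open>(t + 1)\<close>-subset \<open>S\<close>, the users at \<open>spread d S s\<close> with \<open>s \<in> S\<close> are served by one exclusive or:
  user \<open>s\<close> misses the subfile \<open>S - {s}\<close> and has the subfiles \<open>S - {y}\<close> for \<open>y \<noteq> s\<close>.
\<close>

definition spread :: "nat \<Rightarrow> nat set \<Rightarrow> nat \<Rightarrow> nat" where
  "spread d S x = x + (d - 1) * card {y \<in> S. y < x}"

text \<open>At most \<open>card S - 1\<close> blocks precede that of \<open>x\<close>. For
  \<open>card S = t\<close> and \<open>n = K - t * (d - 1)\<close>, the last cache of each block is
  still below \<open>K\<close>: no block wraps around.\<close>

lemma spread_less:
  assumes "finite S" "S \<subseteq> {..<n}" "x \<in> S"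
  shows "spread d S x < n + (d - 1) * (card S - 1)"
proof -
  have "{y \<in> S. y < x} \<subseteq> S - {x}" by auto
  then have "card {y \<in> S. y < x} \<le> card S - 1"
    using assms card_mono[of "S - {x}" "{y \<in> S. y < x}"] by simp
  then have "(d - 1) * card {y \<in> S. y < x} \<le> (d - 1) * (card S - 1)"
    by (rule mult_left_mono) simp
  then show ?thesis
    using assms unfolding spread_def by (meson add_less_le_mono lessThan_iff subsetD)
qed

text \<open>Why the user at \<open>spread d S x\<close> sees the subfile \<open>S - {y}\<close>:
  removing \<open>y < x\<close> moves the block of \<open>x\<close> down by \<open>d - 1\<close>, so
  that its last cache becomes the first of the user's window; removing \<open>y > x\<close> leaves
  it the last one.\<close>

lemma spread_Diff:
  assumes "finite S" "x \<in> S" "y \<in> S" "x \<noteq> y" "d \<ge> 1"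
  shows "spread d (S - {y}) x + (d - 1) \<in> {spread d S x..<spread d S x + d}"
proof (cases "y < x")
  case True
  have "{z \<in> S - {y}. z < x} = {z \<in> S. z < x} - {y}" by auto
  moreover have "card {z \<in> S. z < x} = Suc (card ({z \<in> S. z < x} - {y}))"
    using assms True by (intro card.remove) auto
  ultimately have "card {z \<in> S. z < x} = Suc (card {z \<in> S - {y}. z < x})"
    by simp
  then show ?thesis
    using assms(5) by (cases d) (simp_all add: spread_def)
next
  case False
  then have "{z \<in> S - {y}. z < x} = {z \<in> S. z < x}" by auto
  then show ?thesis
    using assms(5) by (simp add: spread_def)
qed

text \<open>A block contains \<open>k\<close> exactly when its last cache is among
  \<open>k, ..., k + d - 1\<close>, so by \<open>gap\<close> cache \<open>k\<close> lies in no
  block. It survives the contraction as a point \<open>s\<close>, and inserting \<open>s\<close>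
  opens a block starting at \<open>k\<close>.\<close>

lemma spread_fill_gap:
  assumes "finite T" "T \<subseteq> {..<n}" "d \<ge> 1" "k < n + (d - 1) * card T"
    and gap: "\<And>x. x \<in> T \<Longrightarrow> spread d T x + (d - 1) \<notin> {k..<k + d}"
  obtains s where "s < n" "s \<notin> T" "spread d (insert s T) s = k"
proof -
  let ?B = "{x \<in> T. spread d T x + (d - 1) < k}"
  \<comment> \<open>Contraction shortens each block that ends before \<open>k\<close> by
    \<open>d - 1\<close>.\<close>
  define s where "s = k - (d - 1) * card ?B"
  \<comment> \<open>Used for the largest element of \<open>?B\<close>. The second conjunct shows
    that the subtraction in \<open>s\<close> does not truncate.\<close>
  have below: "x < s \<and> (d - 1) * card ?B \<le> k" if x: "x \<in> ?B" "\<And>y. y \<in> ?B \<Longrightarrow> y \<le> x" for x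
  proof -
    have "?B \<subseteq> insert x {y \<in> T. y < x}"
      using x(2) by (auto simp: le_less)
    then have "card ?B \<le> Suc (card {y \<in> T. y < x})"
      using assms(1) card_mono[of "insert x {y \<in> T. y < x}" ?B] by (simp add: card_insert_if)
    then have "(d - 1) * card ?B \<le> (d - 1) * Suc (card {y \<in> T. y < x})"
      by (rule mult_left_mono) simp
    then have "x + (d - 1) * card ?B \<le> spread d T x + (d - 1)"
      by (simp add: spread_def)
    then show ?thesis
      using x(1) unfolding s_def by auto
  qed
  have fin: "finite ?B" using assms(1) by simp
  have le: "(d - 1) * card ?B \<le> k"
  proof (cases "?B = {}")
    case True
    then have "card ?B = 0" by (simp only: card.empty)
    then show ?thesis by (simp only: mult_0_right)
  next
    case False
    then show ?thesis
      using below[of "Max ?B"] fin Max_in[OF fin] by auto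
  qed
  have s: "s + (d - 1) * card ?B = k"
    using le by (simp add: s_def)
  have B_less: "x < s" if "x \<in> ?B" for x
  proof -
    have "Max ?B < s"
      using below[of "Max ?B"] fin Max_in[OF fin] that by auto
    moreover have "x \<le> Max ?B" using that fin by simp
    ultimately show ?thesis by simp
  qed
  \<comment> \<open>The least element \<open>m\<close> outside \<open>?B\<close> suffices: at most
    \<open>card ?B\<close> blocks precede its own, which starts beyond \<open>k\<close>.\<close>
  have greater: "s < x" if "x \<in> T - ?B" for x
  proof -
    define m where "m = Min (T - ?B)"
    have m: "m \<in> T - ?B" "m \<le> x"
      using that assms(1) Min_in[of "T - ?B"] by (auto simp: m_def)
    have "{y \<in> T. y < m} \<subseteq> ?B"
    proof
      fix y assume y: "y \<in> {y \<in> T. y < m}"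
      show "y \<in> ?B"
      proof (rule ccontr)
        assume "y \<notin> ?B"
        then have "y \<in> T - ?B" using y by simp
        then have "m \<le> y"
          unfolding m_def using assms(1) by (intro Min_le) simp_all
        then show False using y by simp
      qed
    qed
    then have "card {y \<in> T. y < m} \<le> card ?B"
      using fin by (intro card_mono)
    then have "(d - 1) * card {y \<in> T. y < m} \<le> (d - 1) * card ?B"
      by (rule mult_left_mono) simp
    moreover have "spread d T m + (d - 1) \<ge> k + d"
      using gap[of m] m(1) by auto
    ultimately have "s < m"
      using s assms(3) unfolding spread_def by linarith
    then show ?thesis using m(2) by simp
  qed
  have s_T: "s \<notin> T"
    using B_less greater by blast
  have "{y \<in> insert s T. y < s} = ?B"
    using B_less greater by fastforce
  then have "spread d (insert s T) s = k"
    using s by (simp only: spread_def)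
  moreover have "s < n"
  proof (cases "T - ?B = {}")
    case True
    then have "?B = T" by auto
    then have "s + (d - 1) * card T = k" using s by simp
    then show ?thesis using assms(4) by linarith
  next
    case False
    then obtain x where "x \<in> T - ?B" by blast
    then show ?thesis using greater[of x] assms(2) by auto
  qed
  ultimately show thesis
    using that s_T by blast
qed


lemma rotate_back:
  fixes a R K :: nat
  assumes "R < K"
  shows "((a + R) mod K + (K - a mod K)) mod K = R"
proof -
  have "((a + R) mod K + (K - a mod K)) mod K = (a mod K + R + (K - a mod K)) mod K"
    by (metis mod_add_left_eq)
  also have "a mod K + R + (K - a mod K) = R + K"
    using assms mod_less_divisor[of K a] by linarith
  finally show ?thesis
    using assms by simp
qed

text \<open>The subfiles carry a rotation \<open>R\<close> as well, which balances the load of the caches.\<close>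

lemma scheme_multicast:
  fixes Q :: "'a set"
  assumes "finite Q" "1 \<le> d" "t * d \<le> K"
  defines "n \<equiv> K - t * (d - 1)"
  shows "scheme K d Q {..<K * (n choose t)} (card Q * (t * (n choose t))) (K * (n choose Suc t))"
proof -
  define Sub where "Sub s = {T. T \<subseteq> {..<n} \<and> card T = s}" for s
  define P where "P = {..<K} \<times> Sub t"
  have t_le: "t * (d - 1) \<le> K"
    using assms(3) mult_le_mono2[of "d - 1" d t] by linarith
  have K: "n + (d - 1) * t = K"
    using t_le by (simp add: n_def mult.commute)
  have fin_Sub: "finite (Sub s)" and card_Sub: "card (Sub s) = n choose s" for s
    using n_subsets[of "{..<n}" s] by (simp_all add: Sub_def)
  have fin_mem: "finite T" if "T \<in> Sub s" for T s
    using that finite_subset by (auto simp: Sub_def)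
  define loc where "loc T x = spread d T x + (d - 1)" for T x
  have loc_less: "loc T x < K" if "T \<in> Sub t" "x \<in> T" for T x
  proof -
    have "t \<ge> 1"
      using that fin_mem[OF that(1)] card_gt_0_iff[of T] by (auto simp: Sub_def)
    then have "(d - 1) * (t - 1) + (d - 1) = (d - 1) * t"
      by (cases t) simp_all
    moreover have "spread d T x < n + (d - 1) * (t - 1)"
      using spread_less[of T n x d] that fin_mem[OF that(1)] by (simp add: Sub_def)
    ultimately show ?thesis
      using K unfolding loc_def by linarith
  qed
  \<comment> \<open>In copy \<open>R\<close> of the placement, cache \<open>c\<close> takes the role
    of cache \<open>c + R\<close>.\<close>
  define stored where "stored c = {RT \<in> P. \<exists>x\<in>snd RT. loc (snd RT) x = (c + fst RT) mod K}" for c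
  define \<Phi> :: "nat \<Rightarrow> (('a \<Rightarrow> nat \<times> nat set \<Rightarrow> bool) \<Rightarrow> bool) set"
    where "\<Phi> c = (\<lambda>(RT, a) w. w a RT) ` (stored c \<times> Q)" for c
  have fin_P: "finite P" by (simp add: P_def fin_Sub)
  then have fin_stored: "finite (stored c)" for c by (simp add: stored_def)
  \<comment> \<open>Given \<open>c\<close>, the set \<open>T\<close> and the point
    \<open>x \<in> T\<close> whose block ends at the rotated cache determine the rotation.\<close>
  have card_stored: "card (stored c) \<le> t * (n choose t)" for c
  proof -
    let ?G = "SIGMA T:Sub t. T"
    let ?g = "\<lambda>(T, x). ((loc T x + (K - c mod K)) mod K, T)"
    have "stored c \<subseteq> ?g ` ?G"
    proof
      fix RT assume "RT \<in> stored c"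
      then obtain x where x: "fst RT < K" "snd RT \<in> Sub t" "x \<in> snd RT"
        and eq: "loc (snd RT) x = (c + fst RT) mod K"
        by (auto simp: stored_def P_def)
      then have "RT = ?g (snd RT, x)"
        using rotate_back[OF x(1), of c] by simp
      then show "RT \<in> ?g ` ?G"
        using x by blast
    qed
    moreover have "finite ?G"
      using fin_Sub fin_mem by blast
    ultimately have "card (stored c) \<le> card ?G"
      using card_mono[of "?g ` ?G" "stored c"] card_image_le[of ?G ?g] by simp
    also have "card ?G = (\<Sum>T\<in>Sub t. card T)"
      using fin_Sub fin_mem by (intro card_SigmaI) blast+
    also have "\<dots> = (\<Sum>T\<in>Sub t. t)"
      by (intro sum.cong) (auto simp: Sub_def)
    finally show ?thesis
      by (simp add: card_Sub mult.commute)
  qed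
  have card_\<Phi>: "finite (\<Phi> c)" "card (\<Phi> c) \<le> card Q * (t * (n choose t))" for c
  proof -
    show "finite (\<Phi> c)"
      using fin_stored assms(1) by (simp add: \<Phi>_def)
    have "card (\<Phi> c) \<le> card (stored c) * card Q"
      using card_image_le[of "stored c \<times> Q"] fin_stored assms(1)
      by (simp add: \<Phi>_def card_cartesian_product)
    also have "\<dots> \<le> t * (n choose t) * card Q"
      by (rule mult_le_mono1[OF card_stored])
    finally show "card (\<Phi> c) \<le> card Q * (t * (n choose t))"
      by (simp only: mult.commute[of "card Q"])
  qed
  have "\<exists>\<Psi>. finite \<Psi> \<and> card \<Psi> \<le> K * (n choose Suc t) \<and> delivers K d P \<Phi> r \<Psi>"
    if r: "r ` {..<K} \<subseteq> Q" for r
  proof -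
    define user where "user R v = (v + (K - R)) mod K" for R v :: nat
    \<comment> \<open>Numbers \<open>0\<close> and \<open>1\<close>, so that \<open>odd\<close> of a
      sum is the exclusive or. The summand of \<open>x\<close> is the bit wanted by the user whose
      rotated number is \<open>spread d S x\<close>.\<close>
    define bits :: "nat \<Rightarrow> nat set \<Rightarrow> ('a \<Rightarrow> nat \<times> nat set \<Rightarrow> bool) \<Rightarrow> nat \<Rightarrow> nat"
      where "bits R S w x = of_bool (w (r (user R (spread d S x))) (R, S - {x}))" for R S w x
    define \<Psi> where "\<Psi> = (\<lambda>(R, S) w. odd (\<Sum>x\<in>S. bits R S w x)) ` ({..<K} \<times> Sub (Suc t))"
    have "delivers K d P \<Phi> r \<Psi>"
    proof (rule deliversI)
      fix k w w' p
      assume k: "k < K" and agr: "agree \<Psi> w w'"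
        and agr': "\<And>j. j < d \<Longrightarrow> agree (\<Phi> ((k + j) mod K)) w w'" and "p \<in> P"
      then obtain R T where p: "p = (R, T)" "R < K" "T \<in> Sub t"
        by (auto simp: P_def)
      define v where "v = (k + R) mod K"
      have v: "v < K" using k by (simp add: v_def)
      \<comment> \<open>Rotated by \<open>R\<close>, user \<open>k\<close> becomes \<open>v\<close>.
        The window \<open>{v..<v + d}\<close> is not reduced modulo \<open>K\<close>, but by
        \<open>loc_less\<close> any location found in it is a cache that the user accesses.\<close>
      have known: "w a (R, T) = w' a (R, T)"
        if "T \<in> Sub t" "x \<in> T" "loc T x \<in> {v..<v + d}" "a \<in> Q" for T x a
      proof -
        define j where "j = loc T x - v"
        have j: "j < d" "loc T x = v + j"
          using that(3) by (auto simp: j_def)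
        have "((k + j) mod K + R) mod K = (v + j) mod K"
          unfolding v_def by (simp add: mod_simps ac_simps)
        also have "\<dots> = loc T x"
          using j(2) loc_less[OF that(1,2)] by simp
        finally have "(R, T) \<in> stored ((k + j) mod K)"
          using that p(2) by (auto simp: stored_def P_def)
        then have "(\<lambda>w. w a (R, T)) \<in> \<Phi> ((k + j) mod K)"
          unfolding \<Phi>_def using that(4) by (intro image_eqI[of _ _ "((R, T), a)"]) auto
        from agreeD[OF agr'[OF j(1)] this] show ?thesis .
      qed
      have rk: "r k \<in> Q" using r k by blast
      show "w (r k) p = w' (r k) p"
      proof (cases "\<exists>x\<in>T. loc T x \<in> {v..<v + d}")
        case True
        then show ?thesis
          using known[OF p(3)] rk p(1) by blast
      next
        case False
        have T: "finite T" "T \<subseteq> {..<n}" "card T = t"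
          using p(3) fin_mem[OF p(3)] by (simp_all add: Sub_def)
        obtain s where s: "s < n" "s \<notin> T" "spread d (insert s T) s = v"
        proof (rule spread_fill_gap[of T n d v])
          show "spread d T x + (d - 1) \<notin> {v..<v + d}" if "x \<in> T" for x
            using False that unfolding loc_def by blast
        qed (use T assms(2) K v in auto)
        define S where "S = insert s T"
        have S: "finite S" "s \<in> S" "S - {s} = T" "S \<in> Sub (Suc t)"
          using s T by (auto simp: S_def Sub_def)
        \<comment> \<open>User \<open>k\<close> is at \<open>spread d S s\<close> and sees the
          subfile \<open>S - {x}\<close> of every file in \<open>Q\<close>, whichever one was
          requested.\<close>
        have others: "bits R S w x = bits R S w' x" if "x \<in> S - {s}" for x
        proof -
          have x: "x \<in> S" "x \<noteq> s" using that by auto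
          have "S - {x} \<in> Sub t"
            using S x by (auto simp: Sub_def)
          moreover have "loc (S - {x}) s \<in> {v..<v + d}"
            using spread_Diff[OF S(1,2) x(1) x(2)[symmetric] assms(2)]
            unfolding loc_def S_def s(3) .
          moreover have "r (user R (spread d S x)) \<in> Q"
            using r k by (auto simp: user_def)
          ultimately show ?thesis
            using known[of "S - {x}" s] S(2) x(2) unfolding bits_def by simp
        qed
        have "odd (\<Sum>x\<in>S. bits R S w x) = odd (\<Sum>x\<in>S. bits R S w' x)"
        proof -
          have "(\<lambda>w. odd (\<Sum>x\<in>S. bits R S w x)) \<in> \<Psi>"
            unfolding \<Psi>_def using p(2) S(4) by (intro image_eqI[of _ _ "(R, S)"]) auto
          from agreeD[OF agr this] show ?thesis .
        qed
        moreover have "(\<Sum>x\<in>S. bits R S u x) = bits R S u s + (\<Sum>x\<in>S - {s}. bits R S u x)" for u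
          using S by (intro sum.remove)
        moreover have "(\<Sum>x\<in>S - {s}. bits R S w x) = (\<Sum>x\<in>S - {s}. bits R S w' x)"
          using others by (intro sum.cong) auto
        ultimately have "odd (bits R S w s) = odd (bits R S w' s)"
          by auto
        moreover have "user R (spread d S s) = k"
          using rotate_back[OF k, of R] p(2) s(3) by (simp add: user_def S_def v_def add.commute)
        ultimately show ?thesis
          by (simp add: bits_def S p(1))
      qed
    qed
    moreover have "card \<Psi> \<le> K * (n choose Suc t)"
      using card_image_le[of "{..<K} \<times> Sub (Suc t)"] fin_Sub
      by (simp add: \<Psi>_def card_cartesian_product card_Sub)
    moreover have "finite \<Psi>"
      by (simp add: \<Psi>_def fin_Sub)
    ultimately show ?thesis by blast
  qed
  then have "scheme K d Q P (card Q * (t * (n choose t))) (K * (n choose Suc t))"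
    unfolding scheme_def using card_\<Phi> by blast
  moreover have "card P = K * (n choose t)"
    by (simp add: P_def card_cartesian_product card_Sub)
  ultimately show ?thesis
    using scheme_enumerate fin_P by metis
qed

section \<open>Memory-rate pairs of one level\<close>

text \<open>One-sided tolerance: memory obeys \<open>\<mu> * F\<close> for every \<open>F\<close>,
  so the shares of the levels add up without loss. \<open>C\<close> absorbs remainders of bounded
  length, \<open>\<epsilon>\<close> the overhead of coded placement.\<close>

definition attains :: "nat \<Rightarrow> nat \<Rightarrow> 'a set \<Rightarrow> real \<Rightarrow> real \<Rightarrow> bool" where
  "attains K d Q \<mu> \<rho> \<longleftrightarrow>
     (\<forall>\<epsilon>>0. \<exists>C. \<forall>F. \<exists>m b. scheme K d Q {..<F} m b \<and>
        real m \<le> \<mu> * real F \<and> real b \<le> (\<rho> + \<epsilon>) * real F + C)"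

lemma attainsE:
  assumes "attains K d Q \<mu> \<rho>" "\<epsilon> > 0"
  obtains C where "\<And>F. \<exists>m b. scheme K d Q {..<F} m b \<and>
    real m \<le> \<mu> * real F \<and> real b \<le> (\<rho> + \<epsilon>) * real F + C"
  using assms unfolding attains_def by blast

lemma attains_mono:
  assumes "attains K d Q \<mu> \<rho>" "\<rho> \<le> \<rho>'"
  shows "attains K d Q \<mu> \<rho>'"
  unfolding attains_def
proof (intro allI impI)
  fix \<epsilon> :: real assume "\<epsilon> > 0"
  from attainsE[OF assms(1) this] obtain C where C: "\<And>F. \<exists>m b. scheme K d Q {..<F} m b \<and>
      real m \<le> \<mu> * real F \<and> real b \<le> (\<rho> + \<epsilon>) * real F + C" by blast
  have "(\<rho> + \<epsilon>) * real F + C \<le> (\<rho>' + \<epsilon>) * real F + C" for F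
    using assms(2) by (intro add_right_mono mult_right_mono) auto
  then show "\<exists>C. \<forall>F. \<exists>m b. scheme K d Q {..<F} m b \<and>
      real m \<le> \<mu> * real F \<and> real b \<le> (\<rho>' + \<epsilon>) * real F + C"
    using C by (meson order_trans)
qed

lemma attains_uncoded: "attains K d Q 0 (real K)"
  unfolding attains_def
proof (intro allI impI, rule exI[of _ 0], rule allI)
  fix \<epsilon> :: real and F :: nat assume "\<epsilon> > 0"
  then have "real K * real F \<le> (real K + \<epsilon>) * real F"
    by (intro mult_right_mono) auto
  moreover have "scheme K d Q {..<F} 0 (K * F)"
    using scheme_uncoded[of "{..<F}" K d Q] by simp
  ultimately show "\<exists>m b. scheme K d Q {..<F} m b \<and>
      real m \<le> 0 * real F \<and> real b \<le> (real K + \<epsilon>) * real F + 0"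
    by (intro exI[of _ 0] exI[of _ "K * F"]) simp
qed

text \<open>With as many pieces of \<open>f\<close> bits as fit, fewer than \<open>f\<close> bits
  remain; sending them uncoded costs at most \<open>K * f\<close>, whatever \<open>F\<close>
  is.\<close>

lemma attains_scheme:
  assumes "scheme K d Q {..<f} m b" "f > 0"
  shows "attains K d Q (real m / real f) (real b / real f)"
  unfolding attains_def
proof (intro allI impI exI[of _ "real (K * f)"])
  fix \<epsilon> :: real and F :: nat assume "\<epsilon> > 0"
  define n where "n = F div f"
  have "n * f \<le> F" by (simp add: n_def)
  then have "real n * real f \<le> real F"
    by (metis of_nat_le_iff of_nat_mult)
  then have "real n \<le> real F / real f"
    using assms(2) by (simp add: pos_le_divide_eq)
  then have n: "real n * x \<le> x / real f * real F" if "x \<ge> 0" for x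
    using mult_right_mono[of "real n" "real F / real f" x] that by (simp add: mult.commute)
  have "scheme K d Q {..<F} (n * m) (n * b + K * (F - n * f))"
    by (rule scheme_fill[OF scheme_repeat[OF assms(1)]]) (simp add: n_def)
  moreover have "F - n * f \<le> f"
    using mod_less_divisor[OF assms(2), of F] by (simp add: n_def minus_div_mult_eq_mod)
  then have "K * (F - n * f) \<le> K * f"
    by (rule mult_left_mono) simp
  then have "real (n * b + K * (F - n * f)) \<le> real n * real b + real (K * f)"
    by (metis add_left_mono of_nat_add of_nat_mono of_nat_mult)
  moreover have "real b / real f * real F \<le> (real b / real f + \<epsilon>) * real F"
    using \<open>\<epsilon> > 0\<close> by (intro mult_right_mono) auto
  ultimately show "\<exists>m' b'. scheme K d Q {..<F} m' b' \<and> real m' \<le> real m / real f * real F \<and>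
      real b' \<le> (real b / real f + \<epsilon>) * real F + real (K * f)"
    using n[of "real m"] n[of "real b"]
    by (intro exI[of _ "n * m"] exI[of _ "n * b + K * (F - n * f)"]) auto
qed

text \<open>For \<open>d * B\<close> bits of each file, a cache keeps \<open>s = B + fact K\<close>
  bits per file instead of \<open>B\<close>. So of every \<open>d * s\<close> bits only
  \<open>d * B\<close> are coded, and the other \<open>d * fact K\<close> are sent uncoded, at rate
  \<open>K * fact K / s\<close>, which a large \<open>B\<close> brings down to
  \<open>\<epsilon>\<close>.\<close>

lemma attains_coded_placement:
  assumes "finite Q" "1 \<le> d" "d \<le> K"
  shows "attains K d Q (real (card Q) / real d) 0"
  unfolding attains_def
proof (intro allI impI)
  fix \<epsilon> :: real assume \<epsilon>: "\<epsilon> > 0"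
  define B where "B = nat \<lceil>real K * fact K / \<epsilon>\<rceil>"
  define s where "s = B + fact K"
  have s: "s > 0" by (simp add: s_def)
  have "real K * fact K / \<epsilon> \<le> real B"
    unfolding B_def by (rule real_nat_ceiling_ge)
  also have "real B \<le> real s" by (simp add: s_def)
  finally have "real K * fact K \<le> \<epsilon> * real s"
    using \<epsilon> by (simp add: pos_divide_le_eq mult.commute)
  then have s_large: "real K * fact K / real s \<le> \<epsilon>"
    using s by (simp add: pos_divide_le_eq)
  show "\<exists>C. \<forall>F. \<exists>m b. scheme K d Q {..<F} m b \<and>
      real m \<le> real (card Q) / real d * real F \<and> real b \<le> (0 + \<epsilon>) * real F + C"
  proof (intro exI[of _ "real (K * (d * s))"] allI)
    fix F
    define n where "n = F div (d * s)"
    have "n * (d * s) \<le> F" by (simp add: n_def)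
    then have "real n * (real d * real s) \<le> real F"
      by (metis of_nat_le_iff of_nat_mult)
    then have n: "real n * real s \<le> real F / real d" "real n * real d \<le> real F / real s"
      using s assms(2) by (simp_all add: pos_le_divide_eq mult.commute mult.left_commute)
    have "d * B \<le> d * s" by (simp add: s_def)
    then have nF: "n * (d * B) \<le> F"
      using \<open>n * (d * s) \<le> F\<close> mult_le_mono2[of "d * B" "d * s" n] by linarith
    have sch: "scheme K d Q {..<F} (n * (card Q * s)) (n * 0 + K * (F - n * (d * B)))"
      unfolding s_def
      by (rule scheme_fill[OF scheme_repeat[OF scheme_coded_placement[OF assms(1,3)]] nF])
    have "real (n * (card Q * s)) = real (card Q) * (real n * real s)"
      by simp
    also have "\<dots> \<le> real (card Q) * (real F / real d)"
      using n(1) by (rule mult_left_mono) simp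
    finally have m: "real (n * (card Q * s)) \<le> real (card Q) / real d * real F"
      by simp
    have "F = n * (d * s) + F mod (d * s)"
      unfolding n_def by (rule div_mult_mod_eq[symmetric])
    moreover have "F mod (d * s) \<le> d * s"
      using s assms(2) by (simp add: less_imp_le)
    ultimately have "F \<le> n * (d * B) + n * d * fact K + d * s"
      by (simp add: s_def algebra_simps)
    then have "F - n * (d * B) \<le> n * d * fact K + d * s"
      by linarith
    then have "real (F - n * (d * B)) \<le> real (n * d * fact K + d * s)"
      by (rule of_nat_mono)
    then have "real K * real (F - n * (d * B)) \<le> real K * real (n * d * fact K + d * s)"
      by (rule mult_left_mono) simp
    also have "\<dots> = real K * fact K * (real n * real d) + real (K * (d * s))"
      by (simp add: algebra_simps)
    also have "real K * fact K * (real n * real d) \<le> real K * fact K * (real F / real s)"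
      using n(2) by (rule mult_left_mono) simp
    also have "\<dots> = real K * fact K / real s * real F"
      by simp
    also have "\<dots> \<le> \<epsilon> * real F"
      using s_large by (rule mult_right_mono) simp
    finally have "real (n * 0 + K * (F - n * (d * B))) \<le> (0 + \<epsilon>) * real F + real (K * (d * s))"
      by simp
    then show "\<exists>m b. scheme K d Q {..<F} m b \<and>
        real m \<le> real (card Q) / real d * real F \<and> real b \<le> (0 + \<epsilon>) * real F + real (K * (d * s))"
      using sch m by blast
  qed
qed

lemma attains_convex:
  assumes "attains K d Q \<mu>0 \<rho>0" "attains K d Q \<mu>1 \<rho>1"
    and "0 \<le> \<mu>0" "0 \<le> \<mu>1" "0 \<le> \<rho>0" "0 \<le> \<rho>1" "0 \<le> \<theta>" "\<theta> \<le> 1"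
  shows "attains K d Q ((1 - \<theta>) * \<mu>0 + \<theta> * \<mu>1) ((1 - \<theta>) * \<rho>0 + \<theta> * \<rho>1)"
  unfolding attains_def
proof (intro allI impI)
  fix \<epsilon> :: real assume \<epsilon>: "\<epsilon> > 0"
  obtain C0 where C0: "\<And>F. \<exists>m b. scheme K d Q {..<F} m b \<and>
      real m \<le> \<mu>0 * real F \<and> real b \<le> (\<rho>0 + \<epsilon>) * real F + C0"
    using attainsE[OF assms(1) \<epsilon>] by blast
  obtain C1 where C1: "\<And>F. \<exists>m b. scheme K d Q {..<F} m b \<and>
      real m \<le> \<mu>1 * real F \<and> real b \<le> (\<rho>1 + \<epsilon>) * real F + C1"
    using attainsE[OF assms(2) \<epsilon>] by blast
  show "\<exists>C. \<forall>F. \<exists>m b. scheme K d Q {..<F} m b \<and>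
      real m \<le> ((1 - \<theta>) * \<mu>0 + \<theta> * \<mu>1) * real F \<and>
      real b \<le> ((1 - \<theta>) * \<rho>0 + \<theta> * \<rho>1 + \<epsilon>) * real F + C"
  proof (intro exI[of _ "C0 + C1 + 2 * real K"] allI)
    fix F :: nat
    \<comment> \<open>Rounding both parts down keeps the memory bound exact; the at most two bits
      left over are sent uncoded.\<close>
    define F0 F1 where "F0 = nat \<lfloor>(1 - \<theta>) * real F\<rfloor>" and "F1 = nat \<lfloor>\<theta> * real F\<rfloor>"
    have nonneg: "0 \<le> (1 - \<theta>) * real F" "0 \<le> \<theta> * real F"
      using assms by auto
    have F0: "real F0 \<le> (1 - \<theta>) * real F" "(1 - \<theta>) * real F < real F0 + 1"
      and F1: "real F1 \<le> \<theta> * real F" "\<theta> * real F < real F1 + 1"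
      using nonneg unfolding F0_def F1_def by linarith+
    have "(1 - \<theta>) * real F + \<theta> * real F = real F"
      by (simp add: algebra_simps)
    then have le: "F0 + F1 \<le> F" and rest: "F - (F0 + F1) \<le> 2"
      using F0 F1 by linarith+
    obtain m0 b0 where 0: "scheme K d Q {..<F0} m0 b0" "real m0 \<le> \<mu>0 * real F0"
      "real b0 \<le> (\<rho>0 + \<epsilon>) * real F0 + C0" using C0 by blast
    obtain m1 b1 where 1: "scheme K d Q {..<F1} m1 b1" "real m1 \<le> \<mu>1 * real F1"
      "real b1 \<le> (\<rho>1 + \<epsilon>) * real F1 + C1" using C1 by blast
    have "scheme K d Q {..<F} (m0 + m1) (b0 + b1 + K * (F - (F0 + F1)))"
      by (rule scheme_fill[OF scheme_append[OF 0(1) 1(1)] le])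
    moreover have "real (m0 + m1) \<le> ((1 - \<theta>) * \<mu>0 + \<theta> * \<mu>1) * real F"
      using 0(2) 1(2) mult_left_mono[OF F0(1) assms(3)] mult_left_mono[OF F1(1) assms(4)]
      by (simp add: algebra_simps)
    moreover have "real (b0 + b1 + K * (F - (F0 + F1))) \<le>
        ((1 - \<theta>) * \<rho>0 + \<theta> * \<rho>1 + \<epsilon>) * real F + (C0 + C1 + 2 * real K)"
    proof -
      have "K * (F - (F0 + F1)) \<le> K * 2"
        using rest by (rule mult_left_mono) simp
      then have "real (K * (F - (F0 + F1))) \<le> 2 * real K"
        by linarith
      moreover have "(\<rho>0 + \<epsilon>) * real F0 \<le> (\<rho>0 + \<epsilon>) * ((1 - \<theta>) * real F)"
        using F0(1) assms(5) \<epsilon> by (intro mult_left_mono) auto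
      moreover have "(\<rho>1 + \<epsilon>) * real F1 \<le> (\<rho>1 + \<epsilon>) * (\<theta> * real F)"
        using F1(1) assms(6) \<epsilon> by (intro mult_left_mono) auto
      moreover have "(\<rho>0 + \<epsilon>) * ((1 - \<theta>) * real F) + (\<rho>1 + \<epsilon>) * (\<theta> * real F) =
          ((1 - \<theta>) * \<rho>0 + \<theta> * \<rho>1 + \<epsilon>) * real F"
        by (simp add: algebra_simps)
      ultimately show ?thesis
        using 0(3) 1(3) unfolding of_nat_add by linarith
    qed
    ultimately show "\<exists>m b. scheme K d Q {..<F} m b \<and>
      real m \<le> ((1 - \<theta>) * \<mu>0 + \<theta> * \<mu>1) * real F \<and>
      real b \<le> ((1 - \<theta>) * \<rho>0 + \<theta> * \<rho>1 + \<epsilon>) * real F + (C0 + C1 + 2 * real K)"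
      by blast
  qed
qed

text \<open>Normalising \<open>scheme_multicast\<close> leaves the ratio of
  \<open>n choose Suc t\<close> to \<open>n choose t\<close>, which is
  \<open>(n - t) / (t + 1)\<close>, and \<open>n - t = K - t * d\<close>.\<close>

lemma attains_multicast:
  assumes "finite Q" "1 \<le> d" "1 \<le> K" "t * d \<le> K"
  shows "attains K d Q (real (card Q) * real t / real K) ((real K - real t * real d) / (real t + 1))"
proof -
  define n where "n = K - t * (d - 1)"
  have split: "t * d = t * (d - 1) + t"
    using assms(2) by (cases d) auto
  then have n: "t \<le> n" "real (n - t) = real K - real t * real d"
    using assms(4) unfolding n_def by (simp_all flip: of_nat_mult of_nat_diff)
  define c where "c = n choose t"
  have c: "c > 0" using n(1) by (simp add: c_def)
  have "Suc t * (n choose Suc t) = (n - t) * c"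
  proof (cases n)
    case (Suc n')
    then show ?thesis
      using binomial_absorb_comp[of n t] Suc_times_binomial[of t n'] by (simp add: c_def)
  qed simp
  then have "(real t + 1) * real (n choose Suc t) = real (n - t) * real c"
    by (metis of_nat_Suc of_nat_mult add.commute)
  then have ratio: "real (n choose Suc t) = real (n - t) * real c / (real t + 1)"
    by (simp add: field_simps)
  have "attains K d Q (real (card Q * (t * c)) / real (K * c)) (real (K * (n choose Suc t)) / real (K * c))"
    using scheme_multicast[OF assms(1,2,4)] c assms(3) unfolding n_def c_def by (intro attains_scheme) auto
  moreover have "real (card Q * (t * c)) / real (K * c) = real (card Q) * real t / real K"
    using c by simp
  moreover have "real (K * (n choose Suc t)) / real (K * c) = (real K - real t * real d) / (real t + 1)"
    using c assms(3) by (simp add: ratio n(2))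
  ultimately show ?thesis by simp
qed

text \<open>
  With \<open>\<tau> = K \<mu> / N\<close> and \<open>t\<close> its integer part, the chord from multicasting at \<open>t\<close> to the
  zero-rate point \<open>\<tau> = K / d\<close> has height \<open>(K - d \<tau>) / (t + 1)\<close> at \<open>\<tau>\<close>, which is below
  \<open>(K - d \<tau>) / \<tau> = N / \<mu> - d\<close>.
\<close>

lemma attains_level:
  assumes "finite Q" "1 \<le> d" "d \<le> K" "card Q \<ge> 1"
    and "real (card Q) / real K \<le> \<mu>" "\<mu> \<le> real (card Q) / real d"
  shows "attains K d Q \<mu> (real (card Q) / \<mu> - real d)"
proof -
  define N where "N = real (card Q)"
  define \<tau> where "\<tau> = real K * \<mu> / N"
  define t where "t = nat \<lfloor>\<tau>\<rfloor>"
  have pos: "N > 0" "real d > 0" "real K > 0"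
    using assms by (auto simp: N_def)
  have \<tau>: "1 \<le> \<tau>" "\<tau> * real d \<le> real K" "N * \<tau> / real K = \<mu>"
  proof -
    have "N \<le> real K * \<mu>" and "\<mu> * real d \<le> N"
      using assms(5,6) pos by (simp_all add: N_def divide_le_eq le_divide_eq mult.commute)
    then show "1 \<le> \<tau>" and "N * \<tau> / real K = \<mu>"
      using pos by (simp_all add: \<tau>_def)
    have "real K * (\<mu> * real d) \<le> real K * N"
      using \<open>\<mu> * real d \<le> N\<close> by (rule mult_left_mono) simp
    then show "\<tau> * real d \<le> real K"
      using pos by (simp add: \<tau>_def divide_le_eq mult.assoc)
  qed
  have t: "real t \<le> \<tau>" "\<tau> < real t + 1"
    using \<tau>(1) unfolding t_def by linarith+
  have td: "real t * real d \<le> \<tau> * real d"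
    using t(1) by (rule mult_right_mono) simp
  then have td_K: "real t * real d \<le> real K"
    using \<tau>(2) by linarith
  then have "t * d \<le> K"
    by (metis of_nat_le_iff of_nat_mult)
  then have multi: "attains K d Q (N * real t / real K) ((real K - real t * real d) / (real t + 1))"
    unfolding N_def using assms by (intro attains_multicast) auto
  have rate: "N / \<mu> - real d = (real K - \<tau> * real d) / \<tau>"
    using \<tau> pos unfolding \<tau>(3)[symmetric] by (simp add: field_simps)
  have chord: "(real K - \<tau> * real d) / (real t + 1) \<le> N / \<mu> - real d"
    unfolding rate using \<tau> t by (intro divide_left_mono) auto
  show ?thesis
  \<comment> \<open>In this case multicasting itself reaches the zero-rate end, and the chord
    shrinks to a point.\<close>
  proof (cases "t * d = K")
    case True
    then have "real t * real d = real K" by (metis of_nat_mult)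
    then have "\<tau> = real t"
      using td \<tau>(2) pos by simp
    then show ?thesis
      using attains_mono[OF multi] chord \<tau>(3) by (simp add: N_def)
  next
    case False
    then have D: "real K - real t * real d > 0"
      using td_K by (metis diff_gt_0_iff_gt of_nat_eq_iff of_nat_mult order_le_less)
    \<comment> \<open>The position of \<open>\<tau>\<close> between \<open>t\<close> and
      \<open>K / d\<close>, with denominators cleared.\<close>
    define \<theta> where "\<theta> = real d * (\<tau> - real t) / (real K - real t * real d)"
    have \<theta>: "0 \<le> \<theta>" "\<theta> \<le> 1"
    proof -
      show "0 \<le> \<theta>"
        unfolding \<theta>_def using D t(1) by (intro divide_nonneg_pos mult_nonneg_nonneg) auto
      have "real d * (\<tau> - real t) \<le> real K - real t * real d"
        using \<tau>(2) by (simp add: algebra_simps)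
      then show "\<theta> \<le> 1"
        unfolding \<theta>_def using D by (simp add: divide_le_eq)
    qed
    have \<theta>_eq: "\<theta> * (real K - real t * real d) = real d * (\<tau> - real t)"
      using D by (simp add: \<theta>_def)
    have "attains K d Q ((1 - \<theta>) * (N * real t / real K) + \<theta> * (N / real d))
        ((1 - \<theta>) * ((real K - real t * real d) / (real t + 1)) + \<theta> * 0)"
      using attains_convex[OF multi attains_coded_placement[OF assms(1-3)] _ _ _ _ \<theta>] pos D
      by (simp add: N_def)
    moreover have "(1 - \<theta>) * (N * real t / real K) + \<theta> * (N / real d) = \<mu>"
    proof -
      have "(1 - \<theta>) * (N * real t / real K) + \<theta> * (N / real d) =
          N / (real K * real d) * (real d * real t + \<theta> * (real K - real t * real d))"
        using pos by (simp add: field_simps)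
      also have "\<dots> = N * \<tau> / real K"
        unfolding \<theta>_eq using pos by (simp add: field_simps)
      finally show ?thesis using \<tau>(3) by simp
    qed
    moreover have "(1 - \<theta>) * ((real K - real t * real d) / (real t + 1)) + \<theta> * 0 =
        (real K - \<tau> * real d) / (real t + 1)"
    proof -
      have "(1 - \<theta>) * (real K - real t * real d) = real K - \<tau> * real d"
        using \<theta>_eq by (simp add: algebra_simps)
      then show ?thesis by (simp add: times_divide_eq_right)
    qed
    ultimately have "attains K d Q \<mu> ((real K - \<tau> * real d) / (real t + 1))"
      by simp
    then show ?thesis
      using chord unfolding N_def by (rule attains_mono)
  qed
qed

section \<open>Packing the functionals into strings\<close>

text \<open>Padding turns the bound on the cardinality into a length that is the same for all files,
  as \<open>deliverable\<close> demands.\<close>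

lemma pack_functionals:
  assumes "finite \<Phi>" "card \<Phi> \<le> m"
  shows "\<exists>h :: ('a \<Rightarrow> 'b \<Rightarrow> bool) \<Rightarrow> bool list.
    (\<forall>w. length (h w) = m) \<and> (\<forall>w w'. h w = h w' \<longrightarrow> agree \<Phi> w w')"
proof -
  obtain xs where xs: "set xs = \<Phi>" "distinct xs"
    using finite_distinct_list[OF assms(1)] by blast
  define h where "h w = map (\<lambda>\<phi>. \<phi> w) xs @ replicate (m - length xs) False"
    for w :: "'a \<Rightarrow> 'b \<Rightarrow> bool"
  have "length xs = card \<Phi>"
    using distinct_card[OF xs(2)] xs(1) by simp
  then have "length (h w) = m" for w
    using assms(2) by (simp add: h_def)
  moreover have "agree \<Phi> w w'" if "h w = h w'" for w w'
    using that xs(1) by (auto simp: h_def agree_def)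
  ultimately show ?thesis by (intro exI[of _ h]) blast
qed

text \<open>Decoding yields the first \<open>F\<close> bits; equality of the strings also needs
  equal lengths, which hold on the support only.\<close>

lemma length_library_pmf:
  assumes "W \<in> set_pmf (library_pmf L N F)" "a \<in> files L N"
  shows "length (W a) = F"
proof -
  have fin: "finite (files L N)"
    by (auto simp: files_def)
  have "{w :: bool list. length w = F} \<noteq> {}"
    using length_replicate[of F True] by blast
  moreover have "finite {w :: bool list. length w = F}"
    using finite_lists_length_eq[of "UNIV :: bool set" F] by simp
  ultimately have "set_pmf (pmf_of_set {w :: bool list. length w = F}) = {w. length w = F}"
    by (rule set_pmf_of_set)
  then show ?thesis
    using assms unfolding library_pmf_def set_Pi_pmf[OF fin] by (cases a) (auto simp: PiE_dflt_def)
qed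

text \<open>The users of level \<open>i\<close> are grouped by their last index into
  \<open>U i\<close> profiles with one user per cache. All profiles share one placement, and each
  adds \<open>b i\<close> to the broadcast.\<close>

lemma deliverable_schemes:
  fixes m b :: "nat \<Rightarrow> nat"
  assumes sch: "\<And>i. i \<in> {1..L} \<Longrightarrow> scheme K (d i) ({i} \<times> {1..N i}) {..<F} (m i) (b i)"
    and mem: "(\<Sum>i=1..L. m i) \<le> c"
  obtains Z :: "nat \<Rightarrow> library \<Rightarrow> bool list"
  where "\<And>k W. length (Z k W) = c"
    and "\<And>r B \<epsilon>. request_profile L K N U r \<Longrightarrow> real (\<Sum>i=1..L. U i * b i) \<le> B \<Longrightarrow> 0 \<le> \<epsilon> \<Longrightarrow>
           deliverable L K N U d F Z r B \<epsilon>"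
proof -
  define bits :: "library \<Rightarrow> nat \<times> nat \<Rightarrow> nat \<Rightarrow> bool" where "bits W a p = W a ! p" for W a p
  have "\<exists>\<Phi> :: nat \<Rightarrow> ((nat \<times> nat \<Rightarrow> nat \<Rightarrow> bool) \<Rightarrow> bool) set.
      (\<forall>c. finite (\<Phi> c) \<and> card (\<Phi> c) \<le> m i) \<and>
      (\<forall>r. r ` {..<K} \<subseteq> {i} \<times> {1..N i} \<longrightarrow>
        (\<exists>\<Psi>. finite \<Psi> \<and> card \<Psi> \<le> b i \<and> delivers K (d i) {..<F} \<Phi> r \<Psi>))" if "i \<in> {1..L}" for i
    using sch[OF that] unfolding scheme_def .
  then obtain \<Phi> :: "nat \<Rightarrow> nat \<Rightarrow> ((nat \<times> nat \<Rightarrow> nat \<Rightarrow> bool) \<Rightarrow> bool) set"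
    where \<Phi>: "\<And>i c. i \<in> {1..L} \<Longrightarrow> finite (\<Phi> i c) \<and> card (\<Phi> i c) \<le> m i"
      and dec: "\<And>i r. i \<in> {1..L} \<Longrightarrow> r ` {..<K} \<subseteq> {i} \<times> {1..N i} \<Longrightarrow>
        \<exists>\<Psi>. finite \<Psi> \<and> card \<Psi> \<le> b i \<and> delivers K (d i) {..<F} (\<Phi> i) r \<Psi>"
    by metis
  \<comment> \<open>Caches count from \<open>1\<close> here and from \<open>0\<close> in
    \<open>delivers\<close>.\<close>
  define \<Phi>' where "\<Phi>' k = (\<Union>i\<in>{1..L}. \<Phi> i (k - 1))" for k
  have \<Phi>': "finite (\<Phi>' k)" "card (\<Phi>' k) \<le> c" for k
  proof -
    show "finite (\<Phi>' k)"
      unfolding \<Phi>'_def using \<Phi> by blast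
    have "card (\<Phi>' k) \<le> (\<Sum>i=1..L. card (\<Phi> i (k - 1)))"
      unfolding \<Phi>'_def by (rule card_UN_le) simp
    also have "\<dots> \<le> (\<Sum>i=1..L. m i)"
      using \<Phi> by (intro sum_mono) blast
    finally show "card (\<Phi>' k) \<le> c"
      using mem by linarith
  qed
  have "\<exists>h :: (nat \<times> nat \<Rightarrow> nat \<Rightarrow> bool) \<Rightarrow> bool list. (\<forall>w. length (h w) = c) \<and> (\<forall>w w'. h w = h w' \<longrightarrow> agree (\<Phi>' k) w w')" for k
    by (rule pack_functionals[OF \<Phi>'])
  then obtain h :: "nat \<Rightarrow> (nat \<times> nat \<Rightarrow> nat \<Rightarrow> bool) \<Rightarrow> bool list"
    where h: "\<And>k w. length (h k w) = c" "\<And>k w w'. h k w = h k w' \<Longrightarrow> agree (\<Phi>' k) w w'"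
    by metis
  define Z where "Z k W = h k (bits W)" for k W
  have len: "length (Z k W) = c" for k W
    by (simp add: Z_def h)
  have "deliverable L K N U d F Z r B \<epsilon>"
    if r: "request_profile L K N U r" and B: "real (\<Sum>i=1..L. U i * b i) \<le> B" and \<epsilon>: "0 \<le> \<epsilon>" for r B \<epsilon>
  proof -
    define req where "req i u k = (i, r (i, k + 1, u))" for i u k :: nat
    have req: "req i u ` {..<K} \<subseteq> {i} \<times> {1..N i}" if "i \<in> {1..L}" "u \<in> {1..U i}" for i u
      using r that unfolding request_profile_def users_def req_def by force
    have "\<exists>\<Psi>. \<forall>i u. i \<in> {1..L} \<longrightarrow> u \<in> {1..U i} \<longrightarrow>
        finite (\<Psi> i u) \<and> card (\<Psi> i u) \<le> b i \<and> delivers K (d i) {..<F} (\<Phi> i) (req i u) (\<Psi> i u)"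
      using dec[OF _ req] by metis
    then obtain \<Psi> where \<Psi>: "\<And>i u. i \<in> {1..L} \<Longrightarrow> u \<in> {1..U i} \<Longrightarrow> finite (\<Psi> i u)"
        "\<And>i u. i \<in> {1..L} \<Longrightarrow> u \<in> {1..U i} \<Longrightarrow> card (\<Psi> i u) \<le> b i"
        "\<And>i u. i \<in> {1..L} \<Longrightarrow> u \<in> {1..U i} \<Longrightarrow> delivers K (d i) {..<F} (\<Phi> i) (req i u) (\<Psi> i u)"
      by blast
    define \<Psi>' where "\<Psi>' = (\<Union>i\<in>{1..L}. \<Union>u\<in>{1..U i}. \<Psi> i u)"
    have "finite \<Psi>'"
      unfolding \<Psi>'_def using \<Psi>(1) by blast
    moreover have "card \<Psi>' \<le> (\<Sum>i=1..L. U i * b i)"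
    proof -
      have "card \<Psi>' \<le> (\<Sum>i=1..L. card (\<Union>u\<in>{1..U i}. \<Psi> i u))"
        unfolding \<Psi>'_def by (rule card_UN_le) simp
      also have "\<dots> \<le> (\<Sum>i=1..L. \<Sum>u=1..U i. card (\<Psi> i u))"
        by (intro sum_mono card_UN_le) simp
      also have "\<dots> \<le> (\<Sum>i=1..L. \<Sum>u=1..U i. b i)"
        using \<Psi>(2) by (intro sum_mono) blast
      finally show ?thesis by simp
    qed
    ultimately have "\<exists>x :: (nat \<times> nat \<Rightarrow> nat \<Rightarrow> bool) \<Rightarrow> bool list.
        (\<forall>w. length (x w) = (\<Sum>i=1..L. U i * b i)) \<and> (\<forall>w w'. x w = x w' \<longrightarrow> agree \<Psi>' w w')"
      by (rule pack_functionals)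
    then obtain x :: "(nat \<times> nat \<Rightarrow> nat \<Rightarrow> bool) \<Rightarrow> bool list"
      where x: "\<And>w. length (x w) = (\<Sum>i=1..L. U i * b i)" "\<And>w w'. x w = x w' \<Longrightarrow> agree \<Psi>' w w'"
      by blast
    define X where "X W = x (bits W)" for W
    define valid where "valid W \<longleftrightarrow> (\<forall>a\<in>files L N. length (W a) = F)" for W :: library
    \<comment> \<open>The decoder picks any well-formed library consistent with its observations;
      decodability makes the requested file the right one.\<close>
    define g where "g v y z = (SOME W. valid W \<and> X W = y \<and> (\<lambda>k\<in>accessed K d v. Z k W) = z) (fst v, r v)"
      for v y z
    have correct: "g v (X W) (\<lambda>k\<in>accessed K d v. Z k W) = W (fst v, r v)"
      if W: "valid W" and v: "v \<in> users L K U" for v W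
    proof -
      define W' where "W' = (SOME V. valid V \<and> X V = X W \<and>
          (\<lambda>k\<in>accessed K d v. Z k V) = (\<lambda>k\<in>accessed K d v. Z k W))"
      have W': "valid W'" "X W' = X W"
          "(\<lambda>k\<in>accessed K d v. Z k W') = (\<lambda>k\<in>accessed K d v. Z k W)"
        using someI[of "\<lambda>V. valid V \<and> X V = X W \<and>
          (\<lambda>k\<in>accessed K d v. Z k V) = (\<lambda>k\<in>accessed K d v. Z k W)" W] W
        unfolding W'_def by blast+
      obtain i k u where v_eq: "v = (i, Suc k, u)" and i: "i \<in> {1..L}" and k: "k < K" and u: "u \<in> {1..U i}"
      proof -
        obtain i k' u where "v = (i, k', u)" "i \<in> {1..L}" "k' \<in> {1..K}" "u \<in> {1..U i}"
          using v by (auto simp: users_def)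
        then show thesis
          using that[of i "k' - 1" u] by auto
      qed
      have requested: "(i, r v) \<in> files L N"
        using req[OF i u] k i unfolding v_eq by (auto simp: req_def files_def)
      have "agree (\<Psi> i u) (bits W') (bits W)"
        using x(2)[of "bits W'" "bits W"] W'(2) i u unfolding X_def \<Psi>'_def agree_UN by blast
      moreover have "agree (\<Phi> i ((k + j) mod K)) (bits W') (bits W)" if "j < d i" for j
      proof -
        have "(k + j) mod K + 1 \<in> accessed K d v"
          using that by (auto simp: accessed_def v_eq)
        then have "Z ((k + j) mod K + 1) W' = Z ((k + j) mod K + 1) W"
          using fun_cong[OF W'(3), of "(k + j) mod K + 1"] by simp
        then show ?thesis
          using h(2)[of "(k + j) mod K + 1" "bits W'" "bits W"] i
          unfolding Z_def \<Phi>'_def agree_UN by simp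
      qed
      ultimately have "bits W' (req i u k) p = bits W (req i u k) p" if "p < F" for p
        using deliversD[OF \<Psi>(3)[OF i u] k] that by blast
      then have "W' (i, r v) = W (i, r v)"
        using W'(1) W requested unfolding valid_def by (intro nth_equalityI) (auto simp: bits_def req_def v_eq)
      then show ?thesis
        unfolding g_def W'_def[symmetric] by (simp add: v_eq)
    qed
    let ?bad = "{W. \<exists>v\<in>users L K U. g v (X W) (\<lambda>k\<in>accessed K d v. Z k W) \<noteq> W (fst v, r v)}"
    have "set_pmf (library_pmf L N F) \<inter> ?bad = {}"
      using correct length_library_pmf unfolding valid_def by blast
    then have "measure_pmf.prob (library_pmf L N F) ?bad = 0"
      by (simp only: measure_pmf_zero_iff)
    then have "measure_pmf.prob (library_pmf L N F) ?bad \<le> \<epsilon>"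
      using \<epsilon> by simp
    moreover have "length (X W) = (\<Sum>i=1..L. U i * b i)" for W
      by (simp add: X_def x)
    ultimately show ?thesis
      unfolding deliverable_def using B by blast
  qed
  then show thesis
    using that[of Z] len by blast
qed

section \<open>From single levels to the whole system\<close>

lemma achievable_levels:
  assumes att: "\<And>i. i \<in> {1..L} \<Longrightarrow> attains K (d i) ({i} \<times> {1..N i}) (\<mu> i) (\<rho> i)"
    and mem: "(\<Sum>i=1..L. \<mu> i) \<le> M" and rate: "(\<Sum>i=1..L. real (U i) * \<rho> i) \<le> R"
  shows "achievable L K N U d R M"
  unfolding achievable_def
proof (intro allI impI)
  fix \<epsilon> :: real assume \<epsilon>: "\<epsilon> > 0"
  \<comment> \<open>The surplus \<open>\<delta>\<close> costs at most
    \<open>\<delta> * u = \<epsilon> / 2\<close> over all levels; the other half absorbs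
    \<open>D\<close> once \<open>F\<close> is large. The \<open>1\<close> keeps \<open>u\<close>
    positive if there are no users.\<close>
  define u where "u = real (\<Sum>i=1..L. U i) + 1"
  have u: "u > 0" unfolding u_def by (intro add_nonneg_pos of_nat_0_le_iff) simp
  define \<delta> where "\<delta> = \<epsilon> / (2 * u)"
  have \<delta>: "\<delta> > 0" using \<epsilon> u by (simp add: \<delta>_def)
  have "\<exists>C. \<forall>F. \<exists>m b. scheme K (d i) ({i} \<times> {1..N i}) {..<F} m b \<and>
      real m \<le> \<mu> i * real F \<and> real b \<le> (\<rho> i + \<delta>) * real F + C" if "i \<in> {1..L}" for i
    using attainsE[OF att[OF that] \<delta>] by metis
  then obtain C where C: "\<And>i F. i \<in> {1..L} \<Longrightarrow> \<exists>m b. scheme K (d i) ({i} \<times> {1..N i}) {..<F} m b \<and>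
      real m \<le> \<mu> i * real F \<and> real b \<le> (\<rho> i + \<delta>) * real F + C i"
    by metis
  define D where "D = (\<Sum>i=1..L. real (U i) * C i)"
  have "\<exists>Z :: nat \<Rightarrow> library \<Rightarrow> bool list. (\<forall>c\<in>{1..K}. \<forall>W. length (Z c W) = nat \<lfloor>M * real F\<rfloor>) \<and>
      (\<forall>r. request_profile L K N U r \<longrightarrow> deliverable L K N U d F Z r ((R + \<epsilon>) * real F) \<epsilon>)"
    if F: "2 * D / \<epsilon> \<le> real F" for F
  proof -
    obtain m b where
      sch: "\<And>i. i \<in> {1..L} \<Longrightarrow> scheme K (d i) ({i} \<times> {1..N i}) {..<F} (m i) (b i)"
      and m: "\<And>i. i \<in> {1..L} \<Longrightarrow> real (m i) \<le> \<mu> i * real F"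
      and b: "\<And>i. i \<in> {1..L} \<Longrightarrow> real (b i) \<le> (\<rho> i + \<delta>) * real F + C i"
      using C[of _ F] by metis
    have "real (\<Sum>i=1..L. m i) \<le> (\<Sum>i=1..L. \<mu> i * real F)"
      unfolding of_nat_sum using m by (intro sum_mono) blast
    also have "\<dots> = (\<Sum>i=1..L. \<mu> i) * real F"
      by (simp add: sum_distrib_right)
    also have "\<dots> \<le> M * real F"
      using mem by (rule mult_right_mono) simp
    finally have m_le: "(\<Sum>i=1..L. m i) \<le> nat \<lfloor>M * real F\<rfloor>"
      by (rule le_nat_floor)
    have "real (\<Sum>i=1..L. U i * b i) = (\<Sum>i=1..L. real (U i) * real (b i))"
      by simp
    also have "\<dots> \<le> (\<Sum>i=1..L. real (U i) * ((\<rho> i + \<delta>) * real F + C i))"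
      using b by (intro sum_mono mult_left_mono) auto
    also have "\<dots> = (\<Sum>i=1..L. real (U i) * \<rho> i) * real F + \<delta> * real F * (\<Sum>i=1..L. real (U i)) + D"
      by (simp add: D_def algebra_simps sum.distrib sum_distrib_left)
    also have "\<dots> \<le> R * real F + \<epsilon> / 2 * real F + \<epsilon> / 2 * real F"
    proof (intro add_mono)
      show "(\<Sum>i=1..L. real (U i) * \<rho> i) * real F \<le> R * real F"
        using rate by (rule mult_right_mono) simp
      have "\<delta> * real F * (\<Sum>i=1..L. real (U i)) \<le> \<delta> * real F * u"
        using \<delta> by (intro mult_left_mono) (auto simp: u_def)
      also have "\<dots> = \<epsilon> / 2 * real F"
        using u by (simp add: \<delta>_def)
      finally show "\<delta> * real F * (\<Sum>i=1..L. real (U i)) \<le> \<epsilon> / 2 * real F" .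
      show "D \<le> \<epsilon> / 2 * real F"
        using F \<epsilon> by (simp add: divide_le_eq mult.commute)
    qed
    also have "\<dots> = (R + \<epsilon>) * real F"
      by (simp add: algebra_simps)
    finally have "real (\<Sum>i=1..L. U i * b i) \<le> (R + \<epsilon>) * real F" .
    with deliverable_schemes[OF sch m_le, where U = U] \<epsilon> show ?thesis
      by (metis less_imp_le)
  qed
  moreover have "\<forall>\<^sub>F F in sequentially. 2 * D / \<epsilon> \<le> real F"
    using filterlim_real_sequentially by (simp add: filterlim_at_top)
  ultimately show "\<forall>\<^sub>F F in sequentially. \<exists>Z :: nat \<Rightarrow> library \<Rightarrow> bool list.
      (\<forall>c\<in>{1..K}. \<forall>W. length (Z c W) = nat \<lfloor>M * real F\<rfloor>) \<and>
      (\<forall>r. request_profile L K N U r \<longrightarrow> deliverable L K N U d F Z r ((R + \<epsilon>) * real F) \<epsilon>)"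
    by (rule eventually_mono[rotated])
qed

theorem theorem1:
  fixes L K :: nat and N U d :: "nat \<Rightarrow> nat" and M :: real and H I J :: "nat set"
  assumes "L \<ge> 1" and "K \<ge> 1"
    and "\<And>i. i \<in> {1..L} \<Longrightarrow> N i \<ge> 1"
    and "\<And>i. i \<in> {1..L} \<Longrightarrow> U i \<ge> 1"
    and "\<And>i. i \<in> {1..L} \<Longrightarrow> 1 \<le> d i \<and> d i \<le> K"
    and "\<And>i. i \<in> {1..L} \<Longrightarrow> N i \<ge> K * U i"
    and "M \<ge> 0"
    and "feasible_partition L K N U d M H I J"
  shows "achievable L K N U d
           ((\<Sum>h\<in>H. real K * real (U h))
            + (\<Sum>i\<in>I. sqrt (real (N i) * real (U i)))\<^sup>2 / (M - (\<Sum>j\<in>J. real (N j) / real (d j)))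
            - (\<Sum>i\<in>I. real (d i) * real (U i)))
           M"
proof -
  note pos = assms(2-5)
  define S T where "S = S_sum N U I" and "T = T_sum N d J"
  have part: "H \<union> I \<union> J = {1..L}" "H \<inter> I = {}" "H \<inter> J = {}" "I \<inter> J = {}"
    and feas_I: "\<And>i. i \<in> I \<Longrightarrow> 1 / real K * sqrt (real (N i) / real (U i)) * S + T \<le> M"
      "\<And>i. i \<in> I \<Longrightarrow> M \<le> 1 / real (d i) * sqrt (real (N i) / real (U i)) * S + T"
    and feas_J: "\<And>j. j \<in> J \<Longrightarrow> 1 / real (d j) * sqrt (real (N j) / real (U j)) * S + T < M"
    using assms(8) unfolding feasible_partition_def S_def T_def by blast+
  have sub: "H \<subseteq> {1..L}" "I \<subseteq> {1..L}" "J \<subseteq> {1..L}"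
    using part(1) by blast+
  then have fin: "finite H" "finite I" "finite J"
    using finite_subset by blast+
  have split: "(\<Sum>i=1..L. f i) = sum f H + sum f I + sum f J" for f :: "nat \<Rightarrow> real"
  proof -
    have "(\<Sum>i=1..L. f i) = sum f (H \<union> I \<union> J)" using part(1) by simp
    also have "\<dots> = sum f (H \<union> I) + sum f J"
      using fin part by (intro sum.union_disjoint) auto
    also have "sum f (H \<union> I) = sum f H + sum f I"
      using fin part by (intro sum.union_disjoint) auto
    finally show ?thesis .
  qed
  define q where "q i = sqrt (real (N i) * real (U i))" for i
  have q: "q i > 0" if "i \<in> {1..L}" for i
    using pos(2,3)[OF that] by (simp add: q_def)
  have S_eq: "S = sum q I" by (simp add: S_def S_sum_def q_def)
  have S_nonneg: "S \<ge> 0"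
    unfolding S_eq using q sub(2) by (intro sum_nonneg less_imp_le) blast
  have S_pos: "S > 0" if "i \<in> I" for i
    unfolding S_eq using q sub fin that by (intro sum_pos) auto
  have "T \<le> M"
  proof (cases "J = {}")
    case True
    then show ?thesis using assms(7) by (simp add: T_def T_sum_def)
  next
    case False
    then obtain j where "j \<in> J" by blast
    moreover have "1 / real (d j) * sqrt (real (N j) / real (U j)) * S \<ge> 0"
      using S_nonneg by simp
    ultimately show ?thesis using feas_J[of j] by linarith
  qed
  have MT: "M - T > 0" if "i \<in> I" for i
  proof -
    have "1 / real K * sqrt (real (N i) / real (U i)) * S > 0"
      using S_pos[OF that] pos(1) pos(2,3)[of i] that sub(2) by auto
    then show ?thesis using feas_I(1)[OF that] by linarith
  qed
  define \<mu> where "\<mu> i = (if i \<in> I then q i * (M - T) / S else if i \<in> J then real (N i) / real (d i) else 0)" for i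
  define \<rho> where "\<rho> i = (if i \<in> I then real (N i) / \<mu> i - real (d i) else if i \<in> J then 0 else real K)" for i
  have \<mu>_I: "real (N i) / real K \<le> \<mu> i" "\<mu> i \<le> real (N i) / real (d i)"
    "real (U i) * (real (N i) / \<mu> i) = q i * (S / (M - T))" if "i \<in> I" for i
  proof -
    have i: "i \<in> {1..L}" using that sub by blast
    note pos_i = S_pos[OF that] MT[OF that] pos(2,3,4)[OF i] q[OF i]
    have root: "sqrt (real (N i) / real (U i)) * q i = real (N i)"
      using pos_i by (simp add: q_def real_sqrt_divide real_sqrt_mult)
    have qq: "q i * q i = real (N i) * real (U i)"
      using pos_i by (simp add: q_def)
    have \<mu>: "\<mu> i = q i * (M - T) / S" using that by (simp add: \<mu>_def)
    \<comment> \<open>By \<open>root\<close>, the factor \<open>q i / S\<close> turns the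
      feasibility bounds on \<open>M - T\<close> into \<open>N i / K\<close> and
      \<open>N i / d i\<close>.\<close>
    have scaled: "1 / x * sqrt (real (N i) / real (U i)) * S * (q i / S) = real (N i) / x" for x :: real
      using root pos_i(1) by (simp add: mult.commute mult.left_commute)
    have "1 / real K * sqrt (real (N i) / real (U i)) * S * (q i / S) \<le> (M - T) * (q i / S)"
      using feas_I(1)[OF that] pos_i by (intro mult_right_mono) auto
    then show "real (N i) / real K \<le> \<mu> i"
      unfolding scaled \<mu> by (simp add: mult.commute)
    have "(M - T) * (q i / S) \<le> 1 / real (d i) * sqrt (real (N i) / real (U i)) * S * (q i / S)"
      using feas_I(2)[OF that] pos_i by (intro mult_right_mono) auto
    then show "\<mu> i \<le> real (N i) / real (d i)"
      unfolding scaled \<mu> by (simp add: mult.commute)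
    have "real (U i) * (real (N i) / \<mu> i) = real (N i) * real (U i) * S / (q i * (M - T))"
      unfolding \<mu> by simp
    also have "\<dots> = q i * q i * S / (q i * (M - T))"
      by (simp only: qq)
    also have "\<dots> = q i * (S / (M - T))"
      using pos_i by simp
    finally show "real (U i) * (real (N i) / \<mu> i) = q i * (S / (M - T))" .
  qed
  have att: "attains K (d i) ({i} \<times> {1..N i}) (\<mu> i) (\<rho> i)" if "i \<in> {1..L}" for i
  proof -
    have card: "card ({i} \<times> {1..N i}) = N i" by (simp add: card_cartesian_product)
    consider "i \<in> I" | "i \<in> J" "i \<notin> I" | "i \<notin> I" "i \<notin> J" by blast
    then show ?thesis
    proof cases
      case 1
      then show ?thesis
        using attains_level[of "{i} \<times> {1..N i}" "d i" K "\<mu> i"] \<mu>_I[OF 1] pos(2,4)[OF that]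
        unfolding card by (simp add: \<rho>_def)
    next
      case 2
      then show ?thesis
        using attains_coded_placement[of "{i} \<times> {1..N i}" "d i" K] pos(4)[OF that]
        unfolding card by (simp add: \<mu>_def \<rho>_def)
    next
      case 3
      then show ?thesis
        using attains_uncoded[of K "d i" "{i} \<times> {1..N i}"] by (simp add: \<mu>_def \<rho>_def)
    qed
  qed
  have in_H: "i \<notin> I" "i \<notin> J" if "i \<in> H" for i
    using that part by blast+
  have in_J: "i \<notin> I" if "i \<in> J" for i
    using that part by blast
  have "(\<Sum>i=1..L. \<mu> i) \<le> M"
  proof -
    have "sum \<mu> H = 0"
      using in_H by (intro sum.neutral) (simp add: \<mu>_def)
    moreover have "sum \<mu> J = T"
      unfolding T_def T_sum_def using in_J by (intro sum.cong) (auto simp: \<mu>_def)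
    moreover have "sum \<mu> I \<le> M - T"
    proof -
      have "sum \<mu> I = (\<Sum>i\<in>I. q i * ((M - T) / S))"
        by (intro sum.cong) (simp_all add: \<mu>_def)
      also have "\<dots> = S * ((M - T) / S)"
        unfolding S_eq by (simp only: sum_distrib_right)
      also have "\<dots> \<le> M - T"
        using \<open>T \<le> M\<close> by (cases "S = 0") simp_all
      finally show ?thesis .
    qed
    ultimately show ?thesis unfolding split by linarith
  qed
  \<comment> \<open>For empty \<open>I\<close> the quotient is \<open>0\<close>, even when
    \<open>M = T\<close>, in line with the stated convention.\<close>
  moreover have "(\<Sum>i=1..L. real (U i) * \<rho> i) =
      (\<Sum>h\<in>H. real K * real (U h)) + S\<^sup>2 / (M - T) - (\<Sum>i\<in>I. real (d i) * real (U i))"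
  proof -
    have "(\<Sum>i\<in>H. real (U i) * \<rho> i) = (\<Sum>h\<in>H. real K * real (U h))"
      using in_H by (intro sum.cong) (simp_all add: \<rho>_def mult.commute)
    moreover have "(\<Sum>i\<in>J. real (U i) * \<rho> i) = 0"
      using in_J by (intro sum.neutral) (simp add: \<rho>_def)
    moreover have "(\<Sum>i\<in>I. real (U i) * \<rho> i) = S\<^sup>2 / (M - T) - (\<Sum>i\<in>I. real (d i) * real (U i))"
    proof -
      have "(\<Sum>i\<in>I. real (U i) * \<rho> i) = (\<Sum>i\<in>I. q i * (S / (M - T)) - real (d i) * real (U i))"
        using \<mu>_I(3) by (intro sum.cong) (simp_all add: \<rho>_def right_diff_distrib mult.commute)
      also have "\<dots> = sum q I * (S / (M - T)) - (\<Sum>i\<in>I. real (d i) * real (U i))"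
        by (simp only: sum_subtractf sum_distrib_right)
      finally show ?thesis by (simp add: S_eq power2_eq_square)
    qed
    ultimately show ?thesis unfolding split by linarith
  qed
  ultimately have "achievable L K N U d
      ((\<Sum>h\<in>H. real K * real (U h)) + S\<^sup>2 / (M - T) - (\<Sum>i\<in>I. real (d i) * real (U i))) M"
    using att by (intro achievable_levels[where \<mu> = \<mu> and \<rho> = \<rho>]) auto
  then show ?thesis
    by (simp only: S_def S_sum_def T_def T_sum_def)
qed

end
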